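(* Let $Q\in M_d(\mathbb{C})$ be a strictly positive diagonal matrix with eigenspaces of dimensions $(d_1,\dots,d_n)$. Then $$H^1(U_Q^+)=H^1(U_{d_1}^+)\oplus\cdots\oplus H^1(U_{d_n}^+)\cong M_{d_1}(\mathbb{C})\oplus\cdots\oplus M_{d_n}(\mathbb{C})$$ as complex vector spaces, where the first identification is via the natural maps $H^1(U_{d_i}^+)\to H^1(U_Q^+)$ given by composition with $\pi_i$.
   Context: For a strictly positive $Q\in M_d(\mathbb{C})$, $A_u(Q)$ denotes the universal complex unital $^*$-algebra generated by elements $u_{jk}$ ($j,k=1,\dots,d$) such that, with $u=(u_{jk})$, $\bar u=(u_{jk}^* )_{j,k}$ and $u^t=(u_{kj})_{j,k}$, $$uu^*=I=u^*u,\qquad u^tQ\bar uQ^{-1}=I=Q\bar uQ^{-1}u^t .$$ It is the $^*$-algebra associated with the universal unitary quantum group $U_Q^+$; $U_d^+:=U_{I_d}^+$ and $A_u(d):=A_u(I_d)$. The distinguished character is the unital $^*$-homomorphism $\epsilon:A_u(Q)\to\mathbb{C}$ with $\epsilon(u_{jk})=\delta_{jk}$. $H^1(U_Q^+):=H^1(A_u(Q),{}_\epsilon\mathbb{C}_\epsilon)$ is the first Hochschild cohomology with trivial coefficients: since $1$-coboundaries vanish, it is the space of linear maps $\eta:A_u(Q)\to\mathbb{C}$ with $\eta(xy)=\epsilon(x)\eta(y)+\eta(x)\epsilon(y)$ for all $x,y$. The eigenspaces are those of the $n$ distinct eigenvalues $q_1,\dots,q_n$ of $Q$. The map $\pi_i:A_u(Q)\to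 A_u(d_i)$ is the surjective unital $^*$-homomorphism sending the generators $u_{jk}$ with $j,k$ in the $i$-th block $\{j: Q_{jj}=q_i\}$ to the corresponding generators of $A_u(d_i)$, and every other $u_{jk}$ to $\delta_{jk}1$; it satisfies $\epsilon\circ\pi_i=\epsilon$. *)

theory Defs
  imports
    "HOL-Library.Poly_Mapping"
    "HOL-Algebra.QuotRing"
    "Jordan_Normal_Form.Matrix_Kernel"
    "Jordan_Normal_Form.Char_Poly"
begin

section \<open>Unital complex star-algebras\<close>

record 'a star_algebra = "(complex, 'a) module" +
  star :: "'a \<Rightarrow> 'a"

definition unital_star_hom ::
  "('a, 'm) star_algebra_scheme \<Rightarrow> ('b, 'n) star_algebra_scheme \<Rightarrow> ('a \<Rightarrow> 'b) set" where
  "unital_star_hom A B = {f \<in> Ring.ring_hom A B.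
     (\<forall>c. \<forall>x\<in>carrier A. f (c \<odot>\<^bsub>A\<^esub> x) = c \<odot>\<^bsub>B\<^esub> f x) \<and>
     (\<forall>x\<in>carrier A. f (star A x) = star B (f x))}"

definition complex_star_algebra :: "complex star_algebra" where
  "complex_star_algebra = \<lparr>carrier = UNIV, monoid.mult = (*), one = 1, zero = 0, add = (+),
     module.smult = (*), star = cnj\<rparr>"

section \<open>The free unital star-algebra\<close>

datatype gen = U nat nat | U_star nat nat

text \<open>Words in the generators form the free monoid. It is written additively, because the
  convolution product of \<^typ>\<open>'a \<Rightarrow>\<^sub>0 'b\<close> is defined for additive monoids.\<close>

datatype gword = Word (letters: "gen list")

instantiation gword :: monoid_add
begin

definition zero_gword :: gword where
  "0 = Word []"

definition plus_gword :: "gword \<Rightarrow> gword \<Rightarrow> gword" where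
  "v + w = Word (letters v @ letters w)"

instance
  by standard (simp_all add: zero_gword_def plus_gword_def)

end

type_synonym free_alg = "gword \<Rightarrow>\<^sub>0 complex"

definition scalar :: "complex \<Rightarrow> free_alg" where
  "scalar c = Poly_Mapping.single 0 c"

definition free_gen :: "nat \<Rightarrow> nat \<Rightarrow> free_alg" where
  "free_gen j k = Poly_Mapping.single (Word [U j k]) 1"

fun gen_star :: "gen \<Rightarrow> gen" where
  "gen_star (U j k) = U_star j k"
| "gen_star (U_star j k) = U j k"

definition word_star :: "gword \<Rightarrow> gword" where
  "word_star w = Word (rev (map gen_star (letters w)))"

text \<open>As \<^const>\<open>word_star\<close> is an involution, the coefficient of \<open>w\<close> in \<open>free_star x\<close> is the
  conjugate of the coefficient of \<open>word_star w\<close> in \<open>x\<close>.\<close>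

definition free_star :: "free_alg \<Rightarrow> free_alg" where
  "free_star x = Poly_Mapping.map cnj (Poly_Mapping.map_key word_star x)"

fun gen_below :: "nat \<Rightarrow> gen \<Rightarrow> bool" where
  "gen_below d (U j k) \<longleftrightarrow> j < d \<and> k < d"
| "gen_below d (U_star j k) \<longleftrightarrow> j < d \<and> k < d"

definition free_ring :: "nat \<Rightarrow> free_alg ring" where
  "free_ring d = \<lparr>carrier = {x. \<forall>w\<in>Poly_Mapping.keys x. \<forall>g\<in>set (letters w). gen_below d g},
     monoid.mult = (*), one = 1, zero = 0, add = (+)\<rparr>"

section \<open>The star-algebra of the universal unitary quantum group\<close>

text \<open>The order on \<^typ>\<open>complex\<close> makes the quadratic form real-valued,
  so that such a matrix is automatically Hermitian.\<close>

definition strictly_positive :: "nat \<Rightarrow> complex mat \<Rightarrow> bool" where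
  "strictly_positive d Q \<longleftrightarrow> Q \<in> carrier_mat d d \<and>
     (\<forall>v\<in>carrier_vec d. v \<noteq> 0\<^sub>v d \<longrightarrow> 0 < (Q *\<^sub>v v) \<bullet>c v)"

definition au_relators :: "complex mat \<Rightarrow> free_alg set" where
  "au_relators Q =
    (let d = dim_row Q;
         u = mat d d (\<lambda>(j, k). free_gen j k);
         ubar = map_mat free_star u;
         q = map_mat scalar Q;
         q' = map_mat scalar (the (mat_inverse Q))
     in elements_mat (u * ubar\<^sup>T - 1\<^sub>m d) \<union> elements_mat (ubar\<^sup>T * u - 1\<^sub>m d) \<union>
        elements_mat (u\<^sup>T * q * ubar * q' - 1\<^sub>m d) \<union>
        elements_mat (q * ubar * q' * u\<^sup>T - 1\<^sub>m d))"

definition au_ideal :: "complex mat \<Rightarrow> free_alg set" where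
  "au_ideal Q = Idl\<^bsub>free_ring (dim_row Q)\<^esub> (au_relators Q \<union> free_star ` au_relators Q)"

definition Au :: "complex mat \<Rightarrow> free_alg set star_algebra" where
  "Au Q =
    (let F = free_ring (dim_row Q); I = au_ideal Q; A = F Quot I
     in \<lparr>carrier = carrier A, monoid.mult = monoid.mult A, one = one A, zero = zero A, add = add A,
         module.smult = (\<lambda>c X. \<Union>x\<in>X. I +>\<^bsub>F\<^esub> (scalar c * x)),
         star = (\<lambda>X. \<Union>x\<in>X. I +>\<^bsub>F\<^esub> free_star x)\<rparr>)"

definition au_gen :: "complex mat \<Rightarrow> nat \<Rightarrow> nat \<Rightarrow> free_alg set" where
  "au_gen Q j k = au_ideal Q +>\<^bsub>free_ring (dim_row Q)\<^esub> free_gen j k"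

text \<open>The unital star-homomorphism with prescribed values on the generators. It is unique once it
  exists; homomorphisms are made \<^const>\<open>undefined\<close> outside the carrier.\<close>

definition au_hom :: "complex mat \<Rightarrow> ('b, 'n) star_algebra_scheme \<Rightarrow> (nat \<Rightarrow> nat \<Rightarrow> 'b)
    \<Rightarrow> free_alg set \<Rightarrow> 'b" where
  "au_hom Q B b = (THE f. f \<in> unital_star_hom (Au Q) B \<and> f \<in> extensional (carrier (Au Q)) \<and>
     (\<forall>j<dim_row Q. \<forall>k<dim_row Q. f (au_gen Q j k) = b j k))"

definition au_counit :: "complex mat \<Rightarrow> free_alg set \<Rightarrow> complex" where
  "au_counit Q = au_hom Q complex_star_algebra (\<lambda>j k. if j = k then 1 else 0)"

text \<open>The entries in a block need not be adjacent; indices in the block are identified with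
  \<open>0, 1, \<dots>\<close> in increasing order.\<close>

definition block :: "complex mat \<Rightarrow> complex \<Rightarrow> nat set" where
  "block Q c = {j. j < dim_row Q \<and> Q $$ (j, j) = c}"

definition block_pos :: "complex mat \<Rightarrow> complex \<Rightarrow> nat \<Rightarrow> nat" where
  "block_pos Q c j = card {l \<in> block Q c. l < j}"

definition block_proj :: "complex mat \<Rightarrow> complex \<Rightarrow> nat \<Rightarrow> free_alg set \<Rightarrow> free_alg set" where
  "block_proj Q c m = au_hom Q (Au (1\<^sub>m m))
     (\<lambda>j k. if j \<in> block Q c \<and> k \<in> block Q c
            then au_gen (1\<^sub>m m) (block_pos Q c j) (block_pos Q c k)
            else if j = k then \<one>\<^bsub>Au (1\<^sub>m m)\<^esub> else \<zero>\<^bsub>Au (1\<^sub>m m)\<^esub>)"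

section \<open>First cohomology with trivial coefficients\<close>

text \<open>The coboundaries \<open>x \<mapsto> \<epsilon> x * c - c * \<epsilon> x\<close> vanish, so the first Hochschild cohomology is
  the space of cocycles.\<close>

definition hochschild_H1 ::
  "('a, 'm) star_algebra_scheme \<Rightarrow> ('a \<Rightarrow> complex) \<Rightarrow> (complex, 'a \<Rightarrow> complex) module" where
  "hochschild_H1 A \<epsilon> = (ring.func_space class_ring (carrier A))
     \<lparr>carrier := {\<eta> \<in> extensional (carrier A).
        (\<forall>x\<in>carrier A. \<forall>y\<in>carrier A. \<eta> (x \<oplus>\<^bsub>A\<^esub> y) = \<eta> x + \<eta> y) \<and>
        (\<forall>c. \<forall>x\<in>carrier A. \<eta> (c \<odot>\<^bsub>A\<^esub> x) = c * \<eta> x) \<and>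
        (\<forall>x\<in>carrier A. \<forall>y\<in>carrier A. \<eta> (x \<otimes>\<^bsub>A\<^esub> y) = \<epsilon> x * \<eta> y + \<eta> x * \<epsilon> y)}\<rparr>"

definition H1_U :: "complex mat \<Rightarrow> (complex, free_alg set \<Rightarrow> complex) module" where
  "H1_U Q = hochschild_H1 (Au Q) (au_counit Q)"

section \<open>Direct sums and isomorphisms of complex vector spaces\<close>

text \<open>Only meant for a finite index set, where direct sum and direct product agree. The fields
  \<^const>\<open>monoid.mult\<close> and \<^const>\<open>one\<close> play no role in a module.\<close>

definition direct_sum_module :: "'i set \<Rightarrow> ('i \<Rightarrow> (complex, 'v, 'm) module_scheme)
    \<Rightarrow> (complex, 'i \<Rightarrow> 'v) module" where
  "direct_sum_module I M = \<lparr>carrier = \<Pi>\<^sub>E i\<in>I. carrier (M i),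
     monoid.mult = undefined, one = undefined,
     zero = (\<lambda>i\<in>I. \<zero>\<^bsub>M i\<^esub>),
     add = (\<lambda>f g. \<lambda>i\<in>I. f i \<oplus>\<^bsub>M i\<^esub> g i),
     module.smult = (\<lambda>c f. \<lambda>i\<in>I. c \<odot>\<^bsub>M i\<^esub> f i)\<rparr>"

definition linear_iso :: "(complex, 'v, 'm) module_scheme \<Rightarrow> (complex, 'w, 'n) module_scheme
    \<Rightarrow> ('v \<Rightarrow> 'w) \<Rightarrow> bool" where
  "linear_iso V W T \<longleftrightarrow> linear_map class_ring V W T \<and> bij_betw T (carrier V) (carrier W)"

end

theory Submission
  imports Defs
begin

text \<open>Over the counit \<open>\<epsilon>\<close>, a functional \<open>\<eta>\<close> with \<open>\<eta> (x y) = \<epsilon> x * \<eta> y + \<eta> x * \<epsilon> y\<close> is the same as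
  a unital homomorphism \<open>x \<mapsto> \<epsilon> x + t * \<eta> x\<close> to the dual numbers. So \<open>\<eta>\<close> is a tangent vector at
  the point \<open>u = I\<close>: it is determined by the matrices \<open>A = (\<eta> u\<^sub>j\<^sub>k)\<close> and \<open>B = (\<eta> u\<^sub>j\<^sub>k\<^sup>*)\<close>, and a
  pair \<open>(A, B)\<close> occurs if and only if it solves the linearised defining relations.

  Let \<open>Q\<close> be diagonal with entries \<open>p\<^sub>j\<close>. Unitarity of \<open>u\<close> linearises to \<open>B k j = - A j k\<close>, and the
  two relations that involve \<open>Q\<close> linearise to \<open>A k j + p j / p k * B j k = 0\<close>. Together they say
  \<open>A k j * (1 - p j / p k) = 0\<close>: the matrix \<open>A\<close> is block diagonal with respect to the eigenspaces
  of \<open>Q\<close>, and otherwise arbitrary (\<open>H1_U_relations\<close>, \<open>H1_U_eqI\<close>, \<open>H1_U_exists\<close>). For an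
  identity matrix there is a single block, hence the matrix algebras.

  The projection \<open>\<pi>\<^sub>i\<close> replaces \<open>u\<close> by a smaller fundamental matrix in the \<open>i\<close>-th block, completed by
  the identity. Composition with it therefore places the matrix of a cocycle in the \<open>i\<close>-th
  block (\<open>H1_U_pullback\<close>), and the sum of these maps assembles a block diagonal matrix from its
  blocks (\<open>linear_iso_pullback\<close>).

  The counit and the projections are definite descriptions of homomorphisms out of the quotient of a
  free algebra. They are brought under control by evaluating the free algebra and descending to
  the quotient (\<open>au_hom_au_class\<close>).\<close>

section \<open>Evaluation on the free star-algebra\<close>

definition gvar :: "gen \<Rightarrow> free_alg" where
  "gvar g = Poly_Mapping.single (Word [g]) 1"

lemma free_gen_eq_gvar: "free_gen j k = gvar (U j k)"
  by (simp add: free_gen_def gvar_def)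

lemma gen_star_gen_star [simp]: "gen_star (gen_star g) = g"
  by (cases g) simp_all

lemma gen_below_gen_star [simp]: "gen_below d (gen_star g) = gen_below d g"
  by (cases g) simp_all

lemma word_star_word_star [simp]: "word_star (word_star w) = w"
  by (simp add: word_star_def rev_map comp_def)

lemma inj_word_star: "inj word_star"
  by (metis injI word_star_word_star)

lemma lookup_free_star:
  "Poly_Mapping.lookup (free_star x) w = cnj (Poly_Mapping.lookup x (word_star w))"
  by (simp add: free_star_def Poly_Mapping.map.rep_eq Poly_Mapping.map_key.rep_eq inj_word_star when_def)

lemma free_star_add: "free_star (x + y) = free_star x + free_star y"
  by (rule poly_mapping_eqI) (simp add: lookup_free_star lookup_add)

lemma free_star_minus: "free_star (x - y) = free_star x - free_star y"
  by (rule poly_mapping_eqI) (simp add: lookup_free_star lookup_minus)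

lemma free_star_single:
  "free_star (Poly_Mapping.single w a) = Poly_Mapping.single (word_star w) (cnj a)"
  by (rule poly_mapping_eqI) (auto simp: lookup_free_star lookup_single when_def)

lemma free_star_zero [simp]: "free_star 0 = 0"
  by (rule poly_mapping_eqI) (simp add: lookup_free_star)

lemma free_star_free_star [simp]: "free_star (free_star x) = x"
  by (rule poly_mapping_eqI) (simp add: lookup_free_star)

lemma free_star_scalar [simp]: "free_star (scalar a) = scalar (cnj a)"
  by (simp add: scalar_def free_star_single word_star_def zero_gword_def)

lemma free_star_gvar [simp]: "free_star (gvar g) = gvar (gen_star g)"
  by (simp add: gvar_def free_star_single word_star_def)

lemma scalar_one [simp]: "scalar 1 = 1"
  by (simp add: scalar_def)

lemma scalar_zero [simp]: "scalar 0 = 0"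
  by (simp add: scalar_def)

lemma free_star_one [simp]: "free_star 1 = 1"
  using free_star_scalar[of 1] by simp

lemma single_Cons:
  "Poly_Mapping.single (Word (g # gs)) (a::complex) = gvar g * Poly_Mapping.single (Word gs) a"
  by (simp add: gvar_def mult_single plus_gword_def)

lemma mem_free_ring:
  "x \<in> carrier (free_ring d) \<longleftrightarrow>
    (\<forall>w\<in>Poly_Mapping.keys x. \<forall>g\<in>set (letters w). gen_below d g)"
  by (simp add: free_ring_def)

lemma free_ring_simps [simp]:
  "\<one>\<^bsub>free_ring d\<^esub> = 1" "\<zero>\<^bsub>free_ring d\<^esub> = 0"
  "x \<otimes>\<^bsub>free_ring d\<^esub> y = x * y" "x \<oplus>\<^bsub>free_ring d\<^esub> y = x + y"
  by (simp_all add: free_ring_def)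

lemma free_ring_add [simp, intro]:
  "x \<in> carrier (free_ring d) \<Longrightarrow> y \<in> carrier (free_ring d) \<Longrightarrow> x + y \<in> carrier (free_ring d)"
  using Poly_Mapping.keys_add[of x y] unfolding mem_free_ring by blast

lemma free_ring_mult [simp, intro]:
  assumes "x \<in> carrier (free_ring d)" "y \<in> carrier (free_ring d)"
  shows "x * y \<in> carrier (free_ring d)"
  unfolding mem_free_ring
proof (intro ballI)
  fix w g
  assume "w \<in> Poly_Mapping.keys (x * y)" and g: "g \<in> set (letters w)"
  then obtain u v where "u \<in> Poly_Mapping.keys x" "v \<in> Poly_Mapping.keys y" "w = u + v"
    using keys_mult[of x y] by blast
  with g assms show "gen_below d g"
    by (auto simp: mem_free_ring plus_gword_def)
qed

lemma free_ring_scalar [simp, intro]: "scalar a \<in> carrier (free_ring d)"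
  by (cases "a = 0") (simp_all add: mem_free_ring scalar_def zero_gword_def)

lemma free_ring_zero [simp, intro]: "0 \<in> carrier (free_ring d)"
  by (simp add: mem_free_ring)

lemma free_ring_one [simp, intro]: "1 \<in> carrier (free_ring d)"
  using free_ring_scalar[of 1] by simp

lemma free_ring_uminus [simp, intro]: "x \<in> carrier (free_ring d) \<Longrightarrow> - x \<in> carrier (free_ring d)"
  by (simp add: mem_free_ring)

lemma free_ring_minus [simp, intro]:
  "x \<in> carrier (free_ring d) \<Longrightarrow> y \<in> carrier (free_ring d) \<Longrightarrow> x - y \<in> carrier (free_ring d)"
  using free_ring_add[of x d "- y"] by simp

lemma free_ring_gvar [simp, intro]: "gen_below d g \<Longrightarrow> gvar g \<in> carrier (free_ring d)"
  by (simp add: mem_free_ring gvar_def)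

lemma free_ring_sum [simp, intro]:
  "(\<And>l. l \<in> L \<Longrightarrow> f l \<in> carrier (free_ring d)) \<Longrightarrow> sum f L \<in> carrier (free_ring d)"
  by (induction L rule: infinite_finite_induct) auto

lemma free_ring_free_star [simp, intro]:
  assumes "x \<in> carrier (free_ring d)"
  shows "free_star x \<in> carrier (free_ring d)"
  unfolding mem_free_ring
proof (intro ballI)
  fix w g
  assume "w \<in> Poly_Mapping.keys (free_star x)" and g: "g \<in> set (letters w)"
  then have "word_star w \<in> Poly_Mapping.keys x"
    by (simp add: in_keys_iff lookup_free_star)
  moreover have "gen_star g \<in> set (letters (word_star w))"
    using g by (simp add: word_star_def)
  ultimately have "gen_below d (gen_star g)"
    using assms unfolding mem_free_ring by blast
  then show "gen_below d g" by simp
qed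

lemma ring_free_ring: "ring (free_ring d)"
proof (rule ringI)
  show "abelian_group (free_ring d)"
    by (rule abelian_groupI) (auto simp: algebra_simps intro: bexI[of _ "- x" for x])
  show "Group.monoid (free_ring d)"
    by (rule monoidI) (auto simp: algebra_simps)
qed (auto simp: algebra_simps)

lemma free_ring_a_minus:
  assumes "x \<in> carrier (free_ring d)" "y \<in> carrier (free_ring d)"
  shows "x \<ominus>\<^bsub>free_ring d\<^esub> y = x - y"
proof -
  interpret ring "free_ring d" by (rule ring_free_ring)
  have "\<ominus>\<^bsub>free_ring d\<^esub> y = - y"
    by (rule minus_equality) (use assms in auto)
  then show ?thesis by (simp add: a_minus_def)
qed

lemma poly_mapping_sum_single:
  fixes x :: "'a \<Rightarrow>\<^sub>0 'b::comm_monoid_add"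
  shows "x = (\<Sum>w\<in>Poly_Mapping.keys x. Poly_Mapping.single w (Poly_Mapping.lookup x w))"
proof (rule poly_mapping_eqI)
  fix v
  show "Poly_Mapping.lookup x v =
    Poly_Mapping.lookup (\<Sum>w\<in>Poly_Mapping.keys x. Poly_Mapping.single w (Poly_Mapping.lookup x w)) v"
    by (cases "v \<in> Poly_Mapping.keys x")
       (auto simp: lookup_sum lookup_single when_def in_keys_iff)
qed

text \<open>Every element of the free algebra is a combination of words and every word is a product of
  generators. Membership in the carrier is handed to the induction steps because the laws of a
  quotient are only available there.\<close>

lemma free_ring_induct [consumes 1, case_names scalar gvar add mult]:
  assumes "x \<in> carrier (free_ring d)"
    and scalar: "\<And>a. P (scalar a)"
    and gvar: "\<And>g. gen_below d g \<Longrightarrow> P (gvar g)"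
    and add: "\<And>x y. x \<in> carrier (free_ring d) \<Longrightarrow> y \<in> carrier (free_ring d) \<Longrightarrow>
      P x \<Longrightarrow> P y \<Longrightarrow> P (x + y)"
    and mult: "\<And>x y. x \<in> carrier (free_ring d) \<Longrightarrow> y \<in> carrier (free_ring d) \<Longrightarrow>
      P x \<Longrightarrow> P y \<Longrightarrow> P (x * y)"
  shows "P x"
proof -
  \<comment> \<open>Membership is carried along, for the hypotheses of \<open>mult\<close>.\<close>
  have word: "P (Poly_Mapping.single (Word gs) a) \<and>
      Poly_Mapping.single (Word gs) a \<in> carrier (free_ring d)"
    if "\<forall>g\<in>set gs. gen_below d g" for gs and a :: complex
    using that
  proof (induction gs)
    case Nil
    show ?case
      using scalar[of a] free_ring_scalar[of a d] by (simp add: scalar_def zero_gword_def)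
  next
    case (Cons g gs)
    then show ?case
      using gvar[of g] mult[of "gvar g" "Poly_Mapping.single (Word gs) a"]
      by (simp add: single_Cons)
  qed
  have "P (\<Sum>w\<in>W. Poly_Mapping.single w (Poly_Mapping.lookup x w)) \<and>
      (\<Sum>w\<in>W. Poly_Mapping.single w (Poly_Mapping.lookup x w)) \<in> carrier (free_ring d)"
    if "finite W" "W \<subseteq> Poly_Mapping.keys x" for W
    using that
  proof (induction W)
    case empty
    show ?case using scalar[of 0] by simp
  next
    case (insert w W)
    have "\<forall>g\<in>set (letters w). gen_below d g"
      using insert.prems assms(1) by (auto simp: mem_free_ring)
    from word[OF this, of "Poly_Mapping.lookup x w"] insert show ?case
      by (auto intro: add)
  qed
  from this[of "Poly_Mapping.keys x"] show ?thesis
    by (simp flip: poly_mapping_sum_single)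
qed

lemma mem_some_free_ring: "\<exists>d. x \<in> carrier (free_ring d)"
proof -
  define G where "G = (\<Union>w\<in>Poly_Mapping.keys x. set (letters w))"
  have "finite G" by (simp add: G_def)
  then have "\<exists>d. \<forall>g\<in>G. gen_below d g"
  proof (induction G)
    case empty
    show ?case by simp
  next
    case (insert g G)
    then obtain d where d: "\<forall>g\<in>G. gen_below d g" by blast
    have mono: "gen_below d h \<Longrightarrow> d \<le> d' \<Longrightarrow> gen_below d' h" for h and d d' :: nat
      by (cases h) auto
    obtain e where "gen_below e g"
    proof (cases g)
      case (U j k)
      show ?thesis by (rule that[of "Suc (max j k)"]) (simp add: U less_Suc_eq_le)
    next
      case (U_star j k)
      show ?thesis by (rule that[of "Suc (max j k)"]) (simp add: U_star less_Suc_eq_le)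
    qed
    with d mono have "\<forall>h\<in>insert g G. gen_below (max d e) h"
      by (metis insertE max.cobounded1 max.cobounded2)
    then show ?case ..
  qed
  then show ?thesis by (auto simp: mem_free_ring G_def)
qed

text \<open>An element involves finitely many generators and so lies in some \<^const>\<open>free_ring\<close>.\<close>

lemma free_alg_induct [case_names scalar gvar add mult]:
  assumes "\<And>a. P (scalar a)" "\<And>g. P (gvar g)"
    "\<And>x y. P x \<Longrightarrow> P y \<Longrightarrow> P (x + y)" "\<And>x y. P x \<Longrightarrow> P y \<Longrightarrow> P (x * y)"
  shows "P x"
proof -
  obtain d where "x \<in> carrier (free_ring d)" using mem_some_free_ring by blast
  then show ?thesis by (induction rule: free_ring_induct) (use assms in auto)
qed

lemma scalar_commute: "scalar a * x = x * scalar a"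
proof -
  have "scalar a * Poly_Mapping.single w b = Poly_Mapping.single w b * scalar a" for w b
    by (simp add: scalar_def mult_single mult.commute)
  then show ?thesis
    by (subst (1 2) poly_mapping_sum_single[of x]) (simp add: sum_distrib_left sum_distrib_right)
qed

lemma scalar_add: "scalar (a + b) = scalar a + scalar b"
  by (simp add: scalar_def single_add)

lemma scalar_mult: "scalar (a * b) = scalar a * scalar b"
  by (simp add: scalar_def mult_single)

lemma free_star_sum: "free_star (sum f L) = (\<Sum>l\<in>L. free_star (f l))"
  by (induction L rule: infinite_finite_induct) (simp_all add: free_star_add)

text \<open>Both sides are biadditive, so the claim reduces to words, where it is reversal of a
  concatenation.\<close>

lemma free_star_mult: "free_star (x * y) = free_star y * free_star x"
proof -
  define X where "X = (\<lambda>w. Poly_Mapping.single w (Poly_Mapping.lookup x w))"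
  define Y where "Y = (\<lambda>w. Poly_Mapping.single w (Poly_Mapping.lookup y w))"
  have x: "x = sum X (Poly_Mapping.keys x)" and y: "y = sum Y (Poly_Mapping.keys y)"
    unfolding X_def Y_def by (rule poly_mapping_sum_single)+
  have single: "free_star (X v * Y w) = free_star (Y w) * free_star (X v)" for v w
    by (simp add: X_def Y_def mult_single free_star_single word_star_def plus_gword_def mult.commute)
  have "free_star (sum X V * sum Y W) = free_star (sum Y W) * free_star (sum X V)" for V W
  proof -
    have "free_star (sum X V * sum Y W) = (\<Sum>v\<in>V. \<Sum>w\<in>W. free_star (Y w) * free_star (X v))"
      by (simp only: sum_product free_star_sum single)
    also have "\<dots> = (\<Sum>w\<in>W. \<Sum>v\<in>V. free_star (Y w) * free_star (X v))"
      by (rule sum.swap)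
    also have "\<dots> = free_star (sum Y W) * free_star (sum X V)"
      by (simp only: sum_product free_star_sum)
    finally show ?thesis .
  qed
  from this[of "Poly_Mapping.keys x" "Poly_Mapping.keys y"] show ?thesis
    unfolding x[symmetric] y[symmetric] .
qed

text \<open>The free algebra is evaluated in three rings, whose complex scalars enter by different
  embeddings \<open>c\<close>: the free algebra itself (for maps between quotients), the complex numbers (for
  the counit) and the complex polynomials (for derivations). Centrality of the scalars is what
  makes evaluation multiplicative.\<close>

locale central_scalars =
  fixes c :: "complex \<Rightarrow> 'r::ring_1"
  assumes c_add: "c (a + b) = c a + c b"
    and c_mult: "c (a * b) = c a * c b"
    and c_one: "c 1 = 1"
    and c_central: "c a * r = r * c a"
begin

definition free_eval :: "(gen \<Rightarrow> 'r) \<Rightarrow> free_alg \<Rightarrow> 'r" where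
  "free_eval \<phi> x = (\<Sum>w\<in>Poly_Mapping.keys x.
     c (Poly_Mapping.lookup x w) * prod_list (map \<phi> (letters w)))"

lemma c_zero: "c 0 = 0"
  using c_add[of 0 0] by simp

lemma free_eval_add: "free_eval \<phi> (x + y) = free_eval \<phi> x + free_eval \<phi> y"
  unfolding free_eval_def
  by (rule setsum_keys_plus_distrib) (simp_all add: c_zero c_add distrib_right)

lemma free_eval_single:
  "free_eval \<phi> (Poly_Mapping.single w a) = c a * prod_list (map \<phi> (letters w))"
  by (simp add: free_eval_def c_zero)

lemma free_eval_zero: "free_eval \<phi> 0 = 0"
  by (simp add: free_eval_def)

lemma free_eval_sum: "free_eval \<phi> (sum f L) = (\<Sum>l\<in>L. free_eval \<phi> (f l))"
  by (induction L rule: infinite_finite_induct) (simp_all add: free_eval_add free_eval_zero)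

lemma free_eval_minus: "free_eval \<phi> (x - y) = free_eval \<phi> x - free_eval \<phi> y"
  using free_eval_add[of \<phi> "x - y" y] by (simp add: algebra_simps)

lemma free_eval_scalar: "free_eval \<phi> (scalar a) = c a"
  by (simp add: scalar_def free_eval_single zero_gword_def)

lemma free_eval_one: "free_eval \<phi> 1 = 1"
  using free_eval_scalar[of \<phi> 1] by (simp add: c_one)

lemma free_eval_gvar: "free_eval \<phi> (gvar g) = \<phi> g"
  by (simp add: gvar_def free_eval_single c_one)

lemma free_eval_mult: "free_eval \<phi> (x * y) = free_eval \<phi> x * free_eval \<phi> y"
proof -
  define X where "X = (\<lambda>w. Poly_Mapping.single w (Poly_Mapping.lookup x w))"
  define Y where "Y = (\<lambda>w. Poly_Mapping.single w (Poly_Mapping.lookup y w))"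
  have x: "x = sum X (Poly_Mapping.keys x)" and y: "y = sum Y (Poly_Mapping.keys y)"
    unfolding X_def Y_def by (rule poly_mapping_sum_single)+
  have single: "free_eval \<phi> (X v * Y w) = free_eval \<phi> (X v) * free_eval \<phi> (Y w)" for v w
  proof -
    have "c a * c b * (p * r) = c a * p * (c b * r)" for a b p r
    proof -
      have "c a * c b * (p * r) = c a * (c b * p) * r" by (simp only: mult.assoc)
      also have "\<dots> = c a * p * (c b * r)" by (simp only: c_central[of b p] mult.assoc)
      finally show ?thesis .
    qed
    then show ?thesis
      by (simp add: X_def Y_def mult_single free_eval_single c_mult plus_gword_def)
  qed
  have "free_eval \<phi> (sum X V * sum Y W) = free_eval \<phi> (sum X V) * free_eval \<phi> (sum Y W)" for V W
    by (simp only: sum_product free_eval_sum single)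
  from this[of "Poly_Mapping.keys x" "Poly_Mapping.keys y"] show ?thesis
    unfolding x[symmetric] y[symmetric] .
qed

lemmas free_eval_simps = free_eval_add free_eval_zero free_eval_sum free_eval_minus
  free_eval_scalar free_eval_one free_eval_gvar free_eval_mult

end

interpretation free_lift: central_scalars scalar
  by standard (rule scalar_add scalar_mult scalar_one scalar_commute)+

interpretation free_char: central_scalars "\<lambda>a. a"
  by standard (simp_all add: mult.commute)

text \<open>Polynomials stand in for the dual numbers: the coefficients of \<open>1\<close> and \<open>t\<close> in a product
  depend only on those two coefficients of the factors.\<close>

interpretation free_dual: central_scalars "\<lambda>a. [:a:]"
  by standard (simp_all add: one_pCons)

section \<open>The quotient by the relators of a diagonal matrix\<close>

text \<open>Negatives come for free, as multiples by the scalar \<open>-1\<close>.\<close>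

lemma free_ring_idealI:
  assumes "K \<subseteq> carrier (free_ring d)" "0 \<in> K"
    and "\<And>x y. x \<in> K \<Longrightarrow> y \<in> K \<Longrightarrow> x + y \<in> K"
    and left: "\<And>x y. x \<in> carrier (free_ring d) \<Longrightarrow> y \<in> K \<Longrightarrow> x * y \<in> K"
    and "\<And>x y. x \<in> K \<Longrightarrow> y \<in> carrier (free_ring d) \<Longrightarrow> x * y \<in> K"
  shows "ideal K (free_ring d)"
proof (rule idealI)
  interpret ring "free_ring d" by (rule ring_free_ring)
  show "ring (free_ring d)" by (rule ring_free_ring)
  have neg: "- x \<in> K" if "x \<in> K" for x
    using left[OF free_ring_uminus[OF free_ring_one] that] by simp
  show "subgroup K (add_monoid (free_ring d))"
  proof (rule add.subgroupI)
    fix x assume x: "x \<in> K"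
    then have "\<ominus>\<^bsub>free_ring d\<^esub> x = - x"
      by (intro minus_equality) (use assms(1) in auto)
    with neg[OF x] show "\<ominus>\<^bsub>free_ring d\<^esub> x \<in> K" by simp
  qed (use assms in auto)
qed (use assms in auto)

text \<open>The entries of the four relator matrices of a diagonal \<open>Q\<close>: conjugation by \<open>Q\<close> shows up as
  the scalar weights in the last two.\<close>

definition free_relators :: "nat \<Rightarrow> (nat \<Rightarrow> complex) \<Rightarrow> free_alg set" where
  "free_relators d p = (\<Union>j\<in>{..<d}. \<Union>k\<in>{..<d}.
     {(\<Sum>l<d. gvar (U j l) * gvar (U_star k l)) - of_bool (j = k),
      (\<Sum>l<d. gvar (U_star l j) * gvar (U l k)) - of_bool (j = k),
      (\<Sum>l<d. scalar (p l / p k) * (gvar (U l j) * gvar (U_star l k))) - of_bool (j = k),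
      (\<Sum>l<d. scalar (p j / p l) * (gvar (U_star j l) * gvar (U k l))) - of_bool (j = k)})"

definition diag_of :: "nat \<Rightarrow> (nat \<Rightarrow> complex) \<Rightarrow> complex mat" where
  "diag_of d p = mat d d (\<lambda>(j, k). if j = k then p j else 0)"

lemma diag_of_carrier [simp]: "diag_of d p \<in> carrier_mat d d"
  by (simp add: diag_of_def)

lemma diag_of_dim [simp]: "dim_row (diag_of d p) = d" "dim_col (diag_of d p) = d"
  by (simp_all add: diag_of_def)

lemma mult_mat_index:
  assumes "A \<in> carrier_mat d d" "B \<in> carrier_mat d d" "j < d" "k < d"
  shows "(A * B) $$ (j, k) = (\<Sum>l<d. A $$ (j, l) * B $$ (l, k))"
  using assms by (simp add: scalar_prod_def lessThan_atLeast0)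

lemma diag_of_mult: "diag_of d p * diag_of d r = diag_of d (\<lambda>j. p j * r j)"
proof (rule eq_matI)
  fix j k assume "j < dim_row (diag_of d (\<lambda>j. p j * r j))" "k < dim_col (diag_of d (\<lambda>j. p j * r j))"
  then have "j < d" "k < d" by simp_all
  then have "(diag_of d p * diag_of d r) $$ (j, k) = (\<Sum>l<d. diag_of d p $$ (j, l) * diag_of d r $$ (l, k))"
    by (intro mult_mat_index) simp_all
  also have "\<dots> = (\<Sum>l<d. if l = j then p j * (if j = k then r j else 0) else 0)"
    by (rule sum.cong) (use \<open>j < d\<close> \<open>k < d\<close> in \<open>auto simp: diag_of_def\<close>)
  finally have "(diag_of d p * diag_of d r) $$ (j, k) = \<dots>" .
  then show "(diag_of d p * diag_of d r) $$ (j, k) = diag_of d (\<lambda>j. p j * r j) $$ (j, k)"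
    using \<open>j < d\<close> \<open>k < d\<close> by (simp add: diag_of_def)
qed simp_all

lemma diag_of_one: "diag_of d (\<lambda>_. 1) = 1\<^sub>m d"
  by (rule eq_matI) (auto simp: diag_of_def)

lemma mat_inverse_diag_of:
  assumes "\<And>j. j < d \<Longrightarrow> p j \<noteq> 0"
  shows "the (mat_inverse (diag_of d p)) = diag_of d (\<lambda>j. 1 / p j)"
proof -
  have one: "diag_of d (\<lambda>j. p j * (1 / p j)) = 1\<^sub>m d" "diag_of d (\<lambda>j. 1 / p j * p j) = 1\<^sub>m d"
    by (rule eq_matI; use assms in \<open>auto simp: diag_of_def\<close>)+
  have inv: "diag_of d p * diag_of d (\<lambda>j. 1 / p j) = 1\<^sub>m d"
    "diag_of d (\<lambda>j. 1 / p j) * diag_of d p = 1\<^sub>m d"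
    by (simp_all only: diag_of_mult one)
  have unit: "diag_of d p \<in> Units (ring_mat TYPE(complex) d ())"
    using inv diag_of_carrier[of d p] diag_of_carrier[of d "\<lambda>j. 1 / p j"]
    unfolding Units_def ring_mat_def by auto
  obtain B where B: "mat_inverse (diag_of d p) = Some B"
  proof (cases "mat_inverse (diag_of d p)")
    case None
    then show thesis using mat_inverse(1)[OF diag_of_carrier None, of "()"] unit by simp
  qed
  from mat_inverse(2)[OF diag_of_carrier B]
  have B': "diag_of d p * B = 1\<^sub>m d" "B \<in> carrier_mat d d" by auto
  have "B = (diag_of d (\<lambda>j. 1 / p j) * diag_of d p) * B"
    using inv B' by simp
  also have "\<dots> = diag_of d (\<lambda>j. 1 / p j) * (diag_of d p * B)"
    by (rule assoc_mult_mat[OF diag_of_carrier diag_of_carrier B'(2)])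
  finally show ?thesis using B B' by simp
qed

lemma mult_diag_right:
  assumes "A \<in> carrier_mat d d" "j < d" "k < d"
  shows "(A * map_mat scalar (diag_of d p)) $$ (j, k) = A $$ (j, k) * scalar (p k)"
proof -
  have "(A * map_mat scalar (diag_of d p)) $$ (j, k) =
      (\<Sum>l<d. A $$ (j, l) * map_mat scalar (diag_of d p) $$ (l, k))"
    using assms by (intro mult_mat_index) simp_all
  also have "\<dots> = (\<Sum>l<d. if l = k then A $$ (j, k) * scalar (p k) else 0)"
    by (rule sum.cong) (use assms in \<open>auto simp: diag_of_def\<close>)
  finally show ?thesis using assms by simp
qed

lemma mult_diag_left:
  assumes "A \<in> carrier_mat d d" "j < d" "k < d"
  shows "(map_mat scalar (diag_of d p) * A) $$ (j, k) = scalar (p j) * A $$ (j, k)"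
proof -
  have "(map_mat scalar (diag_of d p) * A) $$ (j, k) =
      (\<Sum>l<d. map_mat scalar (diag_of d p) $$ (j, l) * A $$ (l, k))"
    using assms by (intro mult_mat_index) simp_all
  also have "\<dots> = (\<Sum>l<d. if l = j then scalar (p j) * A $$ (j, k) else 0)"
    by (rule sum.cong) (use assms in \<open>auto simp: diag_of_def\<close>)
  finally show ?thesis using assms by simp
qed

lemma elements_mat_conv:
  assumes "A \<in> carrier_mat d d"
  shows "elements_mat A = (\<Union>j\<in>{..<d}. \<Union>k\<in>{..<d}. {A $$ (j, k)})"
  using assms by (auto simp: elements_mat_def) blast

lemma scalar_mult_assoc:
  "x * scalar a * y = scalar a * (x * y)" "x * scalar a = scalar a * x"
  "scalar a * (scalar b * x) = scalar (a * b) * x"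
proof -
  show "x * scalar a = scalar a * x" by (rule scalar_commute[symmetric])
  then show "x * scalar a * y = scalar a * (x * y)" by (simp only: mult.assoc)
  show "scalar a * (scalar b * x) = scalar (a * b) * x" by (simp only: scalar_mult mult.assoc)
qed

text \<open>Multiplication by \<open>Q\<close> and by its inverse only rescales rows and columns, and the scalars
  commute with the generators.\<close>

lemma au_relators_diag_of:
  assumes nz: "\<And>j. j < d \<Longrightarrow> p j \<noteq> 0"
  shows "au_relators (diag_of d p) = free_relators d p"
proof -
  define u where "u = mat d d (\<lambda>(j, k). free_gen j k)"
  define v where "v = map_mat free_star u"
  define q where "q = map_mat scalar (diag_of d p)"
  define q' where "q' = map_mat scalar (diag_of d (\<lambda>j. 1 / p j))"
  have [simp]: "u \<in> carrier_mat d d" "v \<in> carrier_mat d d" "q \<in> carrier_mat d d" "q' \<in> carrier_mat d d"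
    by (simp_all add: u_def v_def q_def q'_def)
  have [simp]: "dim_row u = d" "dim_col u = d" "dim_row v = d" "dim_col v = d"
    by (simp_all add: u_def v_def)
  have u [simp]: "u $$ (j, k) = gvar (U j k)" if "j < d" "k < d" for j k
    using that by (simp add: u_def free_gen_eq_gvar)
  have v [simp]: "v $$ (j, k) = gvar (U_star j k)" if "j < d" "k < d" for j k
    using that by (simp add: v_def u_def free_gen_eq_gvar)
  have r1: "(u * v\<^sup>T - 1\<^sub>m d) $$ (j, k) =
      (\<Sum>l<d. gvar (U j l) * gvar (U_star k l)) - of_bool (j = k)" if "j < d" "k < d" for j k
    using that mult_mat_index[of u d "v\<^sup>T" j k] by (simp cong: sum.cong_simp)
  have r2: "(v\<^sup>T * u - 1\<^sub>m d) $$ (j, k) =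
      (\<Sum>l<d. gvar (U_star l j) * gvar (U l k)) - of_bool (j = k)" if "j < d" "k < d" for j k
    using that mult_mat_index[of "v\<^sup>T" d u j k] by (simp cong: sum.cong_simp)
  have r3: "(u\<^sup>T * q * v * q' - 1\<^sub>m d) $$ (j, k) =
      (\<Sum>l<d. scalar (p l / p k) * (gvar (U l j) * gvar (U_star l k))) - of_bool (j = k)"
    if jk: "j < d" "k < d" for j k
  proof -
    have "(u\<^sup>T * q * v * q') $$ (j, k) = (u\<^sup>T * q * v) $$ (j, k) * scalar (1 / p k)"
      unfolding q'_def by (rule mult_diag_right) (use jk in \<open>auto intro!: mult_carrier_mat[of _ d d]\<close>)
    also have "(u\<^sup>T * q * v) $$ (j, k) = (\<Sum>l<d. (u\<^sup>T * q) $$ (j, l) * v $$ (l, k))"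
      by (rule mult_mat_index) (use jk in \<open>auto intro!: mult_carrier_mat[of _ d d]\<close>)
    also have "\<dots> = (\<Sum>l<d. gvar (U l j) * scalar (p l) * gvar (U_star l k))"
      using jk by (intro sum.cong) (simp_all add: q_def mult_diag_right del: index_mult_mat)
    finally have "(u\<^sup>T * q * v * q') $$ (j, k) =
        (\<Sum>l<d. scalar (p l / p k) * (gvar (U l j) * gvar (U_star l k)))"
      by (simp add: scalar_mult_assoc sum_distrib_left mult.assoc mult.commute[of "1 / p k"])
    then show ?thesis using jk by simp
  qed
  have r4: "(q * v * q' * u\<^sup>T - 1\<^sub>m d) $$ (j, k) =
      (\<Sum>l<d. scalar (p j / p l) * (gvar (U_star j l) * gvar (U k l))) - of_bool (j = k)"
    if jk: "j < d" "k < d" for j k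
  proof -
    have "(q * v * q' * u\<^sup>T) $$ (j, k) = (\<Sum>l<d. (q * v * q') $$ (j, l) * u\<^sup>T $$ (l, k))"
      by (rule mult_mat_index) (use jk in \<open>auto intro!: mult_carrier_mat[of _ d d]\<close>)
    also have "\<dots> = (\<Sum>l<d. scalar (p j) * gvar (U_star j l) * scalar (1 / p l) * gvar (U k l))"
      using jk by (intro sum.cong) (simp_all add: q_def q'_def mult_diag_right mult_diag_left mult_carrier_mat[of _ d d] del: index_mult_mat)
    finally have "(q * v * q' * u\<^sup>T) $$ (j, k) =
        (\<Sum>l<d. scalar (p j / p l) * (gvar (U_star j l) * gvar (U k l)))"
      by (simp add: scalar_mult_assoc mult.assoc)
    then show ?thesis using jk by simp
  qed
  have "au_relators (diag_of d p) = elements_mat (u * v\<^sup>T - 1\<^sub>m d) \<union> elements_mat (v\<^sup>T * u - 1\<^sub>m d) \<union>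
      elements_mat (u\<^sup>T * q * v * q' - 1\<^sub>m d) \<union> elements_mat (q * v * q' * u\<^sup>T - 1\<^sub>m d)"
    by (simp add: au_relators_def Let_def mat_inverse_diag_of[OF nz] u_def v_def q_def q'_def)
  also have "\<dots> = (\<Union>j\<in>{..<d}. \<Union>k\<in>{..<d}. {(u * v\<^sup>T - 1\<^sub>m d) $$ (j, k), (v\<^sup>T * u - 1\<^sub>m d) $$ (j, k),
      (u\<^sup>T * q * v * q' - 1\<^sub>m d) $$ (j, k), (q * v * q' * u\<^sup>T - 1\<^sub>m d) $$ (j, k)})"
    by (subst (1 2 3 4) elements_mat_conv[of _ d]) auto
  also have "\<dots> = free_relators d p"
    unfolding free_relators_def
    by (intro SUP_cong refl) (simp only: lessThan_iff r1 r2 r3 r4)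
  finally show ?thesis .
qed

definition au_class :: "complex mat \<Rightarrow> free_alg \<Rightarrow> free_alg set" where
  "au_class Q x = au_ideal Q +>\<^bsub>free_ring (dim_row Q)\<^esub> x"

text \<open>One setting for the given matrix \<open>Q\<close>, with its eigenvalues as weights, and for the identity
  matrices that belong to its blocks, with all weights equal to \<open>1\<close>.\<close>

locale diag_weights =
  fixes Q :: "complex mat" and d :: nat and p :: "nat \<Rightarrow> complex"
  assumes Q_eq: "Q = diag_of d p"
    and weight_nonzero: "j < d \<Longrightarrow> p j \<noteq> 0"
begin

lemma dim_Q [simp]: "dim_row Q = d"
  by (simp add: Q_eq)

lemma relators_eq: "au_relators Q = free_relators d p"
  unfolding Q_eq by (rule au_relators_diag_of) (rule weight_nonzero)

lemma relators_closed: "au_relators Q \<union> free_star ` au_relators Q \<subseteq> carrier (free_ring d)"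
proof -
  have "free_relators d p \<subseteq> carrier (free_ring d)"
    by (auto simp: free_relators_def intro!: free_ring_minus free_ring_sum free_ring_mult)
  then show ?thesis by (auto simp: relators_eq)
qed

lemma ideal_au_ideal: "ideal (au_ideal Q) (free_ring d)"
proof -
  interpret ring "free_ring d" by (rule ring_free_ring)
  show ?thesis unfolding au_ideal_def dim_Q by (rule genideal_ideal[OF relators_closed])
qed

lemma au_ideal_minimal:
  assumes "ideal K (free_ring d)" "\<And>r. r \<in> free_relators d p \<Longrightarrow> r \<in> K \<and> free_star r \<in> K"
  shows "au_ideal Q \<subseteq> K"
proof -
  interpret ring "free_ring d" by (rule ring_free_ring)
  show ?thesis unfolding au_ideal_def dim_Q
    by (rule genideal_minimal[OF assms(1)]) (use assms(2) in \<open>auto simp: relators_eq\<close>)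
qed

lemma relator_in_au_ideal: "r \<in> free_relators d p \<Longrightarrow> r \<in> au_ideal Q \<and> free_star r \<in> au_ideal Q"
proof -
  interpret ring "free_ring d" by (rule ring_free_ring)
  show "r \<in> free_relators d p \<Longrightarrow> r \<in> au_ideal Q \<and> free_star r \<in> au_ideal Q"
    unfolding au_ideal_def dim_Q using genideal_self[OF relators_closed] by (auto simp: relators_eq)
qed

lemma au_ideal_closed:
  "x \<in> au_ideal Q \<Longrightarrow> x \<in> carrier (free_ring d)"
  "0 \<in> au_ideal Q"
  "x \<in> au_ideal Q \<Longrightarrow> y \<in> au_ideal Q \<Longrightarrow> x + y \<in> au_ideal Q"
  "x \<in> carrier (free_ring d) \<Longrightarrow> y \<in> au_ideal Q \<Longrightarrow> x * y \<in> au_ideal Q"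
  "x \<in> au_ideal Q \<Longrightarrow> y \<in> carrier (free_ring d) \<Longrightarrow> x * y \<in> au_ideal Q"
proof -
  interpret ideal "au_ideal Q" "free_ring d" by (rule ideal_au_ideal)
  show "x \<in> au_ideal Q \<Longrightarrow> x \<in> carrier (free_ring d)" by (rule Icarr)
  show "0 \<in> au_ideal Q"
    using additive_subgroup.zero_closed[OF ideal.axioms(1)[OF ideal_au_ideal]] by simp
  show "x \<in> au_ideal Q \<Longrightarrow> y \<in> au_ideal Q \<Longrightarrow> x + y \<in> au_ideal Q" using additive_subgroup.a_closed[OF ideal.axioms(1)[OF ideal_au_ideal], of x y] by simp
  show "x \<in> carrier (free_ring d) \<Longrightarrow> y \<in> au_ideal Q \<Longrightarrow> x * y \<in> au_ideal Q"
    using I_l_closed[of y x] by simp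
  show "x \<in> au_ideal Q \<Longrightarrow> y \<in> carrier (free_ring d) \<Longrightarrow> x * y \<in> au_ideal Q"
    using I_r_closed[of x y] by simp
qed

text \<open>The generating set is closed under the star. So the elements whose star lies in the ideal form an
  ideal that contains the generators.\<close>

lemma au_ideal_free_star:
  assumes "x \<in> au_ideal Q"
  shows "free_star x \<in> au_ideal Q"
proof -
  have "ideal {x \<in> carrier (free_ring d). free_star x \<in> au_ideal Q} (free_ring d)"
    by (rule free_ring_idealI) (auto simp: free_star_add free_star_mult intro: au_ideal_closed)
  then have "au_ideal Q \<subseteq> {x \<in> carrier (free_ring d). free_star x \<in> au_ideal Q}"
    using relator_in_au_ideal by (intro au_ideal_minimal) (auto intro: au_ideal_closed)
  with assms show ?thesis by blast
qed

lemma au_class_eq_iff: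
  assumes "x \<in> carrier (free_ring d)" "y \<in> carrier (free_ring d)"
  shows "au_class Q x = au_class Q y \<longleftrightarrow> x - y \<in> au_ideal Q"
proof -
  interpret ring "free_ring d" by (rule ring_free_ring)
  show ?thesis
    using quotient_eq_iff_same_a_r_cos[OF ideal_au_ideal assms] assms
    by (simp add: au_class_def free_ring_a_minus)
qed

lemma mem_au_class:
  assumes "x \<in> carrier (free_ring d)"
  shows "z \<in> au_class Q x \<longleftrightarrow> z \<in> carrier (free_ring d) \<and> au_class Q z = au_class Q x"
proof -
  have "z \<in> au_class Q x \<longleftrightarrow> (\<exists>i\<in>au_ideal Q. z = i + x)"
    by (auto simp: au_class_def a_r_coset_def')
  also have "\<dots> \<longleftrightarrow> z \<in> carrier (free_ring d) \<and> z - x \<in> au_ideal Q"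
    using assms au_ideal_closed(1) by (metis add_diff_cancel diff_add_cancel free_ring_add)
  finally show ?thesis using au_class_eq_iff[OF _ assms] by auto
qed

lemma carrier_Au: "carrier (Au Q) = au_class Q ` carrier (free_ring d)"
  by (auto simp: Au_def Let_def FactRing_def A_RCOSETS_def' au_class_def)

lemma one_Au: "\<one>\<^bsub>Au Q\<^esub> = au_class Q 1"
  by (simp add: Au_def Let_def FactRing_def au_class_def)

lemma zero_Au: "\<zero>\<^bsub>Au Q\<^esub> = au_class Q 0"
proof -
  interpret ideal "au_ideal Q" "free_ring d" by (rule ideal_au_ideal)
  have "au_class Q 0 = au_ideal Q"
    using a_rcos_zero[OF ideal_au_ideal au_ideal_closed(2)] by (simp add: au_class_def)
  then show ?thesis by (simp add: Au_def Let_def FactRing_def)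
qed

lemma au_class_ops:
  assumes "x \<in> carrier (free_ring d)" "y \<in> carrier (free_ring d)"
  shows add_Au: "au_class Q x \<oplus>\<^bsub>Au Q\<^esub> au_class Q y = au_class Q (x + y)"
    and mult_Au: "au_class Q x \<otimes>\<^bsub>Au Q\<^esub> au_class Q y = au_class Q (x * y)"
proof -
  interpret ideal "au_ideal Q" "free_ring d" by (rule ideal_au_ideal)
  note h = rcos_ring_hom
  show "au_class Q x \<oplus>\<^bsub>Au Q\<^esub> au_class Q y = au_class Q (x + y)"
    using ring_hom_add[OF h assms] by (simp add: Au_def Let_def au_class_def)
  show "au_class Q x \<otimes>\<^bsub>Au Q\<^esub> au_class Q y = au_class Q (x * y)"
    using ring_hom_mult[OF h assms] by (simp add: Au_def Let_def au_class_def)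
qed

lemma smult_Au:
  assumes "x \<in> carrier (free_ring d)"
  shows "a \<odot>\<^bsub>Au Q\<^esub> au_class Q x = au_class Q (scalar a * x)"
proof -
  have const: "au_class Q (scalar a * z) = au_class Q (scalar a * x)" if "z \<in> au_class Q x" for z
  proof -
    from that have z: "z \<in> carrier (free_ring d)" "z - x \<in> au_ideal Q"
      using assms by (auto simp: mem_au_class au_class_eq_iff)
    have "scalar a * z - scalar a * x \<in> au_ideal Q"
      using au_ideal_closed(4)[OF free_ring_scalar z(2)] by (simp add: right_diff_distrib)
    with z assms show ?thesis by (simp add: au_class_eq_iff)
  qed
  have "x \<in> au_class Q x" using assms by (simp add: mem_au_class)
  then have "(\<Union>z\<in>au_class Q x. au_class Q (scalar a * z)) = au_class Q (scalar a * x)"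
    by (rule UN_constant_eq) (intro ballI const)
  then show ?thesis by (simp add: Au_def Let_def au_class_def)
qed

lemma star_Au:
  assumes "x \<in> carrier (free_ring d)"
  shows "star (Au Q) (au_class Q x) = au_class Q (free_star x)"
proof -
  have const: "au_class Q (free_star z) = au_class Q (free_star x)" if "z \<in> au_class Q x" for z
  proof -
    from that have z: "z \<in> carrier (free_ring d)" "z - x \<in> au_ideal Q"
      using assms by (auto simp: mem_au_class au_class_eq_iff)
    have "free_star z - free_star x \<in> au_ideal Q"
      using au_ideal_free_star[OF z(2)] by (simp add: free_star_minus)
    with z assms show ?thesis by (simp add: au_class_eq_iff)
  qed
  have "x \<in> au_class Q x" using assms by (simp add: mem_au_class)
  then have "(\<Union>z\<in>au_class Q x. au_class Q (free_star z)) = au_class Q (free_star x)"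
    by (rule UN_constant_eq) (intro ballI const)
  then show ?thesis by (simp add: Au_def Let_def au_class_def)
qed

lemma au_gen_eq: "au_gen Q j k = au_class Q (gvar (U j k))"
  by (simp add: au_gen_def au_class_def free_gen_eq_gvar)

text \<open>Evaluation at an arbitrary representative; it is meaningful for functions that are constant on
  the cosets of the ideal.\<close>

definition descend :: "(free_alg \<Rightarrow> 'b) \<Rightarrow> free_alg set \<Rightarrow> 'b" where
  "descend h = (\<lambda>X\<in>carrier (Au Q). h (SOME x. x \<in> carrier (free_ring d) \<and> au_class Q x = X))"

lemma descend_au_class:
  assumes "x \<in> carrier (free_ring d)"
    and "\<And>x y. x \<in> carrier (free_ring d) \<Longrightarrow> y \<in> carrier (free_ring d) \<Longrightarrow>
      x - y \<in> au_ideal Q \<Longrightarrow> h x = h y"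
  shows "descend h (au_class Q x) = h x"
proof -
  let ?y = "SOME y. y \<in> carrier (free_ring d) \<and> au_class Q y = au_class Q x"
  have "?y \<in> carrier (free_ring d) \<and> au_class Q ?y = au_class Q x"
    by (rule someI[of _ x]) (simp add: assms)
  then have "h ?y = h x" using assms by (auto simp: au_class_eq_iff)
  then show ?thesis using assms(1) by (simp add: descend_def carrier_Au)
qed

text \<open>The star carries agreement from the \<open>u\<^sub>j\<^sub>k\<close> to their adjoints, and together with the scalars these
  generate everything.\<close>

lemma unital_star_hom_eqI:
  assumes f: "f \<in> unital_star_hom (Au Q) B" and g: "g \<in> unital_star_hom (Au Q) B"
    and gen: "\<And>j k. j < d \<Longrightarrow> k < d \<Longrightarrow> f (au_gen Q j k) = g (au_gen Q j k)"
    and x: "x \<in> carrier (free_ring d)"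
  shows "f (au_class Q x) = g (au_class Q x)"
proof -
  have cl: "au_class Q y \<in> carrier (Au Q)" if "y \<in> carrier (free_ring d)" for y
    using that by (simp add: carrier_Au)
  have fg: "f \<in> Ring.ring_hom (Au Q) B" "g \<in> Ring.ring_hom (Au Q) B"
    using f g by (simp_all add: unital_star_hom_def)
  show ?thesis using x
  proof (induction rule: free_ring_induct)
    case (scalar a)
    have "h (au_class Q (scalar a)) = a \<odot>\<^bsub>B\<^esub> \<one>\<^bsub>B\<^esub>" if "h \<in> unital_star_hom (Au Q) B" for h
    proof -
      have "h (a \<odot>\<^bsub>Au Q\<^esub> au_class Q 1) = a \<odot>\<^bsub>B\<^esub> h (au_class Q 1)"
        using that cl[OF free_ring_one] by (simp add: unital_star_hom_def)
      moreover have "h (au_class Q 1) = \<one>\<^bsub>B\<^esub>"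
        using that ring_hom_one[of h "Au Q" B] by (simp add: unital_star_hom_def one_Au)
      ultimately show ?thesis by (simp add: smult_Au)
    qed
    from this[OF f] this[OF g] show ?case by simp
  next
    case (gvar x)
    show ?case
    proof (cases x)
      case (U j k)
      then show ?thesis using gvar gen[of j k] by (simp add: au_gen_eq)
    next
      case (U_star j k)
      have jk: "j < d" "k < d" using gvar U_star by auto
      have "h (au_class Q (free_star (gvar (U j k)))) = star B (h (au_gen Q j k))"
        if "h \<in> unital_star_hom (Au Q) B" for h
        using that cl[of "gvar (U j k)"] jk star_Au[of "gvar (U j k)"]
        by (auto simp: unital_star_hom_def au_gen_eq)
      from this[OF f] this[OF g] show ?thesis using gen[OF jk] U_star by simp
    qed
  next
    case (add x y)
    then show ?case
      using ring_hom_add[OF fg(1) cl cl, of x y] ring_hom_add[OF fg(2) cl cl, of x y]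
      by (simp add: add_Au)
  next
    case (mult x y)
    then show ?case
      using ring_hom_mult[OF fg(1) cl cl, of x y] ring_hom_mult[OF fg(2) cl cl, of x y]
      by (simp add: mult_Au)
  qed
qed

text \<open>The universal property: \<^const>\<open>au_hom\<close> is a definite description, and a map \<open>h\<close> on the free
  algebra that respects the operations and the ideal supplies the homomorphism it describes,
  with its values on all classes.\<close>

lemma au_hom_au_class:
  fixes B :: "('b, 'n) star_algebra_scheme"
  assumes closed: "\<And>x. x \<in> carrier (free_ring d) \<Longrightarrow> h x \<in> carrier B"
    and add: "\<And>x y. x \<in> carrier (free_ring d) \<Longrightarrow> y \<in> carrier (free_ring d) \<Longrightarrow> h (x + y) = h x \<oplus>\<^bsub>B\<^esub> h y"
    and mult: "\<And>x y. x \<in> carrier (free_ring d) \<Longrightarrow> y \<in> carrier (free_ring d) \<Longrightarrow> h (x * y) = h x \<otimes>\<^bsub>B\<^esub> h y"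
    and one: "h 1 = \<one>\<^bsub>B\<^esub>"
    and smult: "\<And>a x. x \<in> carrier (free_ring d) \<Longrightarrow> h (scalar a * x) = a \<odot>\<^bsub>B\<^esub> h x"
    and star: "\<And>x. x \<in> carrier (free_ring d) \<Longrightarrow> h (free_star x) = star B (h x)"
    and const: "\<And>x y. x \<in> carrier (free_ring d) \<Longrightarrow> y \<in> carrier (free_ring d) \<Longrightarrow>
      x - y \<in> au_ideal Q \<Longrightarrow> h x = h y"
    and gen: "\<And>j k. j < d \<Longrightarrow> k < d \<Longrightarrow> h (gvar (U j k)) = b j k"
  shows "au_hom Q B b \<in> unital_star_hom (Au Q) B"
    and "x \<in> carrier (free_ring d) \<Longrightarrow> au_hom Q B b (au_class Q x) = h x"
proof -
  have cl: "descend h (au_class Q y) = h y" if "y \<in> carrier (free_ring d)" for y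
    using that const by (rule descend_au_class)
  have hom: "descend h \<in> unital_star_hom (Au Q) B"
  proof -
    have "descend h \<in> Ring.ring_hom (Au Q) B"
      by (rule ring_hom_memI) (auto simp: carrier_Au one_Au cl add_Au mult_Au closed add mult one)
    moreover have "descend h (a \<odot>\<^bsub>Au Q\<^esub> X) = a \<odot>\<^bsub>B\<^esub> descend h X" if "X \<in> carrier (Au Q)" for a X
      using that by (auto simp: carrier_Au cl smult_Au smult)
    moreover have "descend h (star (Au Q) X) = star B (descend h X)" if "X \<in> carrier (Au Q)" for X
      using that by (auto simp: carrier_Au cl star_Au star)
    ultimately show ?thesis by (simp add: unital_star_hom_def)
  qed
  have gens: "descend h (au_gen Q j k) = b j k" if "j < d" "k < d" for j k
    using that by (simp add: au_gen_eq cl gen)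
  have "au_hom Q B b = descend h"
    unfolding au_hom_def dim_Q
  proof (rule the_equality)
    show "descend h \<in> unital_star_hom (Au Q) B \<and> descend h \<in> extensional (carrier (Au Q)) \<and>
        (\<forall>j<d. \<forall>k<d. descend h (au_gen Q j k) = b j k)"
      using hom gens by (simp add: descend_def)
    fix f
    assume f: "f \<in> unital_star_hom (Au Q) B \<and> f \<in> extensional (carrier (Au Q)) \<and>
        (\<forall>j<d. \<forall>k<d. f (au_gen Q j k) = b j k)"
    show "f = descend h"
    proof (rule extensionalityI)
      show "f \<in> extensional (carrier (Au Q))" "descend h \<in> extensional (carrier (Au Q))"
        using f by (simp_all add: descend_def)
      fix X assume "X \<in> carrier (Au Q)"
      then obtain x where x: "x \<in> carrier (free_ring d)" "X = au_class Q x"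
        by (auto simp: carrier_Au)
      show "f X = descend h X"
        unfolding x(2) by (rule unital_star_hom_eqI[OF _ hom _ x(1)]) (use f gens in simp_all)
    qed
  qed
  then show "au_hom Q B b \<in> unital_star_hom (Au Q) B"
    and "x \<in> carrier (free_ring d) \<Longrightarrow> au_hom Q B b (au_class Q x) = h x"
    using hom cl by simp_all
qed

end

lemma diag_weights_one: "diag_weights (1\<^sub>m m) m (\<lambda>_. 1)"
  by standard (simp_all add: diag_of_one)

section \<open>Derivations over the counit\<close>

fun counit_gen :: "gen \<Rightarrow> complex" where
  "counit_gen (U j k) = of_bool (j = k)"
| "counit_gen (U_star j k) = of_bool (j = k)"

definition free_counit :: "free_alg \<Rightarrow> complex" where
  "free_counit = free_char.free_eval counit_gen"

text \<open>A first-order perturbation of the counit: \<open>u \<mapsto> I + t A\<close> and \<open>u\<^sup>* \<mapsto> I + t B\<close> entrywise, where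
  \<open>B\<close> is indexed like the conjugate matrix of \<open>u\<close>.\<close>

fun tangent_gen :: "(nat \<Rightarrow> nat \<Rightarrow> complex) \<Rightarrow> (nat \<Rightarrow> nat \<Rightarrow> complex) \<Rightarrow> gen \<Rightarrow> complex poly" where
  "tangent_gen A B (U j k) = [:of_bool (j = k), A j k:]"
| "tangent_gen A B (U_star j k) = [:of_bool (j = k), B j k:]"

text \<open>As evaluation in the dual numbers is multiplicative, its coefficient of \<open>t\<close> obeys the Leibniz
  rule over its constant coefficient, the counit.\<close>

definition free_derivation ::
    "(nat \<Rightarrow> nat \<Rightarrow> complex) \<Rightarrow> (nat \<Rightarrow> nat \<Rightarrow> complex) \<Rightarrow> free_alg \<Rightarrow> complex" where
  "free_derivation A B x = poly.coeff (free_dual.free_eval (tangent_gen A B) x) 1"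

lemma free_counit_simps [simp]:
  "free_counit (x + y) = free_counit x + free_counit y"
  "free_counit (x - y) = free_counit x - free_counit y"
  "free_counit (x * y) = free_counit x * free_counit y"
  "free_counit (sum f L) = (\<Sum>l\<in>L. free_counit (f l))"
  "free_counit (scalar a) = a" "free_counit 0 = 0" "free_counit 1 = 1"
  "free_counit (gvar g) = counit_gen g"
  by (simp_all add: free_counit_def free_char.free_eval_simps)

lemma free_counit_of_bool [simp]: "free_counit (of_bool P) = of_bool P"
  by (cases P) simp_all

lemma coeff_0_tangent: "poly.coeff (free_dual.free_eval (tangent_gen A B) x) 0 = free_counit x"
proof (induction x rule: free_alg_induct)
  case (gvar g)
  then show ?case by (cases g) (simp_all add: free_dual.free_eval_simps)
qed (simp_all add: free_dual.free_eval_simps coeff_mult)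

lemma free_derivation_simps [simp]:
  "free_derivation A B (x + y) = free_derivation A B x + free_derivation A B y"
  "free_derivation A B (x - y) = free_derivation A B x - free_derivation A B y"
  "free_derivation A B (x * y) =
    free_counit x * free_derivation A B y + free_derivation A B x * free_counit y"
  "free_derivation A B (sum f L) = (\<Sum>l\<in>L. free_derivation A B (f l))"
  "free_derivation A B (scalar a) = 0" "free_derivation A B 0 = 0" "free_derivation A B 1 = 0"
  "free_derivation A B (gvar (U j k)) = A j k" "free_derivation A B (gvar (U_star j k)) = B j k"
  by (simp_all add: free_derivation_def free_dual.free_eval_simps coeff_sum coeff_mult coeff_0_tangent
      one_pCons)

lemma free_derivation_of_bool [simp]: "free_derivation A B (of_bool P) = 0"
  by (cases P) simp_all

lemma free_counit_free_star: "free_counit (free_star x) = cnj (free_counit x)"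
proof (induction x rule: free_alg_induct)
  case (gvar g)
  then show ?case by (cases g) simp_all
qed (simp_all add: free_star_add free_star_mult)

text \<open>On adjoints, a derivation is the conjugate of another derivation of the same kind. Hence the
  adjoint relators need no computation of their own.\<close>

lemma free_derivation_free_star:
  "free_derivation A B (free_star x) =
    cnj (free_derivation (\<lambda>j k. cnj (B j k)) (\<lambda>j k. cnj (A j k)) x)"
proof (induction x rule: free_alg_induct)
  case (gvar g)
  then show ?case by (cases g) simp_all
qed (simp_all add: free_star_add free_star_mult free_counit_free_star)

lemma sum_of_bool_mult:
  fixes f :: "nat \<Rightarrow> complex"
  assumes "j < d"
  shows "(\<Sum>l<d. of_bool (j = l) * f l) = f j" "(\<Sum>l<d. of_bool (l = j) * f l) = f j"
    "(\<Sum>l<d. f l * of_bool (j = l)) = f j" "(\<Sum>l<d. f l * of_bool (l = j)) = f j"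
proof -
  have "of_bool P * x = (if P then x else 0)" "x * of_bool P = (if P then x else 0)" for P and x :: complex
    by simp_all
  then show "(\<Sum>l<d. of_bool (j = l) * f l) = f j" "(\<Sum>l<d. of_bool (l = j) * f l) = f j"
    "(\<Sum>l<d. f l * of_bool (j = l)) = f j" "(\<Sum>l<d. f l * of_bool (l = j)) = f j"
    using assms by simp_all
qed

lemma (in diag_weights) free_relators_cases [consumes 1, case_names 1 2 3 4]:
  assumes "r \<in> free_relators d p"
  obtains j k where "j < d" "k < d"
      "r = (\<Sum>l<d. gvar (U j l) * gvar (U_star k l)) - of_bool (j = k)"
  | j k where "j < d" "k < d"
      "r = (\<Sum>l<d. gvar (U_star l j) * gvar (U l k)) - of_bool (j = k)"
  | j k where "j < d" "k < d"
      "r = (\<Sum>l<d. scalar (p l / p k) * (gvar (U l j) * gvar (U_star l k))) - of_bool (j = k)"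
  | j k where "j < d" "k < d"
      "r = (\<Sum>l<d. scalar (p j / p l) * (gvar (U_star j l) * gvar (U k l))) - of_bool (j = k)"
  using assms unfolding free_relators_def by blast

context diag_weights
begin

lemma free_counit_relator:
  assumes "r \<in> free_relators d p"
  shows "free_counit r = 0"
  using assms
proof (cases rule: free_relators_cases)
  case (1 j k)
  then show ?thesis using sum_of_bool_mult(1)[of j d "\<lambda>l. of_bool (k = l)"] by auto
next
  case (2 j k)
  then show ?thesis using sum_of_bool_mult(2)[of j d "\<lambda>l. of_bool (l = k)"] by auto
next
  case (3 j k)
  then show ?thesis
    using sum_of_bool_mult(2)[of j d "\<lambda>l. p l / p k * of_bool (l = k)"] weight_nonzero
    by (auto simp: ac_simps)
next
  case (4 j k)
  then show ?thesis
    using sum_of_bool_mult(1)[of j d "\<lambda>l. p j / p l * of_bool (k = l)"] weight_nonzero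
    by (auto simp: ac_simps)
qed

text \<open>The linearisation of the defining relations at \<open>u = I\<close>. The first two relations yield one and
  the same equation, and so do the last two.\<close>

lemma free_derivation_relators:
  assumes "j < d" "k < d"
  shows "free_derivation A B ((\<Sum>l<d. gvar (U j l) * gvar (U_star k l)) - of_bool (j = k)) =
      A j k + B k j"
    and "free_derivation A B ((\<Sum>l<d. gvar (U_star l j) * gvar (U l k)) - of_bool (j = k)) =
      A j k + B k j"
    and "free_derivation A B
        ((\<Sum>l<d. scalar (p l / p k) * (gvar (U l j) * gvar (U_star l k))) - of_bool (j = k)) =
      A k j + p j / p k * B j k"
    and "free_derivation A B
        ((\<Sum>l<d. scalar (p j / p l) * (gvar (U_star j l) * gvar (U k l))) - of_bool (j = k)) =
      A k j + p j / p k * B j k"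
proof -
  show "free_derivation A B ((\<Sum>l<d. gvar (U j l) * gvar (U_star k l)) - of_bool (j = k)) =
      A j k + B k j"
    "free_derivation A B ((\<Sum>l<d. gvar (U_star l j) * gvar (U l k)) - of_bool (j = k)) =
      A j k + B k j"
    using assms by (simp_all add: sum.distrib sum_of_bool_mult)
  have "(\<Sum>l<d. p l / p k * (of_bool (l = j) * B l k + A l j * of_bool (l = k))) =
      (\<Sum>l<d. of_bool (l = j) * (p l / p k * B l k)) + (\<Sum>l<d. (p l / p k * A l j) * of_bool (l = k))"
    unfolding sum.distrib[symmetric] by (rule sum.cong) (simp_all add: algebra_simps)
  also have "\<dots> = A k j + p j / p k * B j k"
    using assms weight_nonzero[of k] by (simp only: sum_of_bool_mult) simp
  finally show "free_derivation A B
        ((\<Sum>l<d. scalar (p l / p k) * (gvar (U l j) * gvar (U_star l k))) - of_bool (j = k)) =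
      A k j + p j / p k * B j k"
    by simp
  have "(\<Sum>l<d. p j / p l * (of_bool (j = l) * A k l + B j l * of_bool (k = l))) =
      (\<Sum>l<d. of_bool (j = l) * (p j / p l * A k l)) + (\<Sum>l<d. (p j / p l * B j l) * of_bool (k = l))"
    unfolding sum.distrib[symmetric] by (rule sum.cong) (simp_all add: algebra_simps)
  also have "\<dots> = A k j + p j / p k * B j k"
    using assms weight_nonzero[of j] by (simp only: sum_of_bool_mult) simp
  finally show "free_derivation A B
        ((\<Sum>l<d. scalar (p j / p l) * (gvar (U_star j l) * gvar (U k l))) - of_bool (j = k)) =
      A k j + p j / p k * B j k"
    by simp
qed

text \<open>The solutions of the linearised relations: substituting \<open>B j k = - A k j\<close> into
  \<open>A k j + p j / p k * B j k = 0\<close> leaves \<open>A k j * (1 - p j / p k) = 0\<close>, so \<open>A\<close> may be nonzero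
  only between equal weights.\<close>

definition admissible :: "(nat \<Rightarrow> nat \<Rightarrow> complex) \<Rightarrow> (nat \<Rightarrow> nat \<Rightarrow> complex) \<Rightarrow> bool" where
  "admissible A B \<longleftrightarrow>
    (\<forall>j<d. \<forall>k<d. B k j = - A j k \<and> (p j \<noteq> p k \<longrightarrow> A j k = 0))"

lemma free_derivation_relator_zero:
  assumes AB: "admissible A B" and r: "r \<in> free_relators d p"
  shows "free_derivation A B r = 0"
proof -
  have key: "A k j + p j / p k * B j k = 0" if "j < d" "k < d" for j k
    using AB that weight_nonzero[of k] unfolding admissible_def
    by (cases "p j = p k") (force)+
  from r show ?thesis
  proof (cases rule: free_relators_cases)
    case (1 j k)
    then show ?thesis using AB by (simp only: free_derivation_relators) (simp add: admissible_def)
  next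
    case (2 j k)
    then show ?thesis using AB by (simp only: free_derivation_relators) (simp add: admissible_def)
  next
    case (3 j k)
    then show ?thesis using key by (simp only: free_derivation_relators)
  next
    case (4 j k)
    then show ?thesis using key by (simp only: free_derivation_relators)
  qed
qed

text \<open>The kernel of a derivation alone need not be an ideal, but its intersection with the kernel of the
  counit is: it is the kernel of evaluation in the dual numbers.\<close>

lemma derivation_vanishes:
  assumes AB: "admissible A B" and x: "x \<in> au_ideal Q"
  shows "free_counit x = 0" "free_derivation A B x = 0"
proof -
  \<comment> \<open>This pair governs the adjoint relators, by \<open>free_derivation_free_star\<close>.\<close>
  have AB': "admissible (\<lambda>j k. cnj (B j k)) (\<lambda>j k. cnj (A j k))"
    using AB unfolding admissible_def
    by (metis complex_cnj_minus complex_cnj_zero minus_minus neg_equal_0_iff_equal)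
  define K where "K = {x \<in> carrier (free_ring d). free_counit x = 0 \<and> free_derivation A B x = 0}"
  have "ideal K (free_ring d)"
    by (rule free_ring_idealI) (auto simp: K_def)
  moreover have "r \<in> K \<and> free_star r \<in> K" if "r \<in> free_relators d p" for r
    using relator_in_au_ideal[OF that] that
    by (auto simp: K_def au_ideal_closed(1) free_counit_relator free_derivation_relator_zero AB AB'
        free_counit_free_star free_derivation_free_star)
  ultimately have "au_ideal Q \<subseteq> K" by (rule au_ideal_minimal)
  with x show "free_counit x = 0" "free_derivation A B x = 0" by (auto simp: K_def)
qed

lemma free_counit_au_ideal: "x \<in> au_ideal Q \<Longrightarrow> free_counit x = 0"
  using derivation_vanishes(1)[of "\<lambda>_ _. 0" "\<lambda>_ _. 0"] by (simp add: admissible_def)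

lemma au_counit_au_class:
  assumes "x \<in> carrier (free_ring d)"
  shows "au_counit Q (au_class Q x) = free_counit x"
  unfolding au_counit_def
proof (rule au_hom_au_class(2)[OF _ _ _ _ _ _ _ _ assms])
  fix x y assume "x - y \<in> au_ideal Q"
  from free_counit_au_ideal[OF this] show "free_counit x = free_counit y" by simp
qed (simp_all add: complex_star_algebra_def free_counit_free_star)

lemma H1_U_iff:
  "\<eta> \<in> carrier (H1_U Q) \<longleftrightarrow> \<eta> \<in> extensional (carrier (Au Q)) \<and>
    (\<forall>x\<in>carrier (free_ring d). \<forall>y\<in>carrier (free_ring d).
      \<eta> (au_class Q (x + y)) = \<eta> (au_class Q x) + \<eta> (au_class Q y) \<and>
      \<eta> (au_class Q (x * y)) =
        free_counit x * \<eta> (au_class Q y) + \<eta> (au_class Q x) * free_counit y) \<and>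
    (\<forall>a. \<forall>x\<in>carrier (free_ring d). \<eta> (au_class Q (scalar a * x)) = a * \<eta> (au_class Q x))"
  by (auto simp: H1_U_def hochschild_H1_def carrier_Au add_Au mult_Au smult_Au au_counit_au_class)

text \<open>From \<open>1 * 1 = 1\<close> the Leibniz rule gives \<open>\<eta> 1 = \<eta> 1 + \<eta> 1\<close>.\<close>

lemma H1_U_scalar:
  assumes "\<eta> \<in> carrier (H1_U Q)"
  shows "\<eta> (au_class Q (scalar a)) = 0"
proof -
  have "\<eta> (au_class Q (1 * 1)) = 1 * \<eta> (au_class Q 1) + \<eta> (au_class Q 1) * 1"
    using assms free_ring_one[of d] unfolding H1_U_iff by (metis free_counit_simps(7))
  then have "\<eta> (au_class Q 1) = 0" by simp
  moreover have "\<eta> (au_class Q (scalar a * 1)) = a * \<eta> (au_class Q 1)"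
    using assms free_ring_one[of d] unfolding H1_U_iff by blast
  ultimately show ?thesis by simp
qed

text \<open>A cocycle is the derivation with the tangent matrices that it prescribes on the generators.\<close>

lemma H1_U_au_class:
  assumes \<eta>: "\<eta> \<in> carrier (H1_U Q)" and x: "x \<in> carrier (free_ring d)"
  shows "\<eta> (au_class Q x) = free_derivation (\<lambda>j k. \<eta> (au_class Q (gvar (U j k))))
    (\<lambda>j k. \<eta> (au_class Q (gvar (U_star j k)))) x"
  using x
proof (induction rule: free_ring_induct)
  case (scalar a)
  show ?case using H1_U_scalar[OF \<eta>] by simp
next
  case (gvar g)
  show ?case by (cases g) simp_all
qed (use \<eta> in \<open>simp_all add: H1_U_iff\<close>)

text \<open>A cocycle kills the relators, so its tangent matrices solve the linearised relations.\<close>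

lemma H1_U_relations:
  assumes \<eta>: "\<eta> \<in> carrier (H1_U Q)" and jk: "j < d" "k < d"
  shows "\<eta> (au_class Q (gvar (U_star k j))) = - \<eta> (au_gen Q j k)"
    and "p j \<noteq> p k \<Longrightarrow> \<eta> (au_gen Q j k) = 0"
proof -
  define A where "A = (\<lambda>j k. \<eta> (au_class Q (gvar (U j k))))"
  define B where "B = (\<lambda>j k. \<eta> (au_class Q (gvar (U_star j k))))"
  have zero: "free_derivation A B r = 0" if "r \<in> free_relators d p" for r
  proof -
    have r: "r \<in> au_ideal Q" "r \<in> carrier (free_ring d)"
      using relator_in_au_ideal[OF that] au_ideal_closed(1) by auto
    then have "au_class Q r = au_class Q (scalar 0)" by (simp add: au_class_eq_iff)
    then have "\<eta> (au_class Q r) = 0" using H1_U_scalar[OF \<eta>, of 0] by simp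
    then show ?thesis using H1_U_au_class[OF \<eta> r(2)] by (simp add: A_def B_def)
  qed
  have anti: "A j k + B k j = 0" if "j < d" "k < d" for j k
    unfolding free_derivation_relators(1)[OF that, symmetric]
    by (rule zero) (use that in \<open>auto simp: free_relators_def\<close>)
  have weight: "A j k + p k / p j * B k j = 0"
    unfolding free_derivation_relators(3)[OF jk(2,1), symmetric]
    by (rule zero) (use jk in \<open>auto simp: free_relators_def\<close>)
  show B: "\<eta> (au_class Q (gvar (U_star k j))) = - \<eta> (au_gen Q j k)"
    using anti[OF jk] by (simp add: A_def B_def au_gen_eq eq_neg_iff_add_eq_0 add.commute)
  show "\<eta> (au_gen Q j k) = 0" if "p j \<noteq> p k"
  proof -
    from anti[OF jk] have "B k j = - A j k" by (simp add: eq_neg_iff_add_eq_0 add.commute)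
    with weight have "A j k * (p j - p k) = 0"
      using weight_nonzero[OF jk(1)] by (simp add: field_simps)
    with that show ?thesis by (simp add: A_def au_gen_eq)
  qed
qed

text \<open>The values on the adjoint generators follow from those on the \<open>u\<^sub>j\<^sub>k\<close>, by
  \<open>H1_U_relations\<close>.\<close>

lemma H1_U_eqI:
  assumes \<eta>: "\<eta> \<in> carrier (H1_U Q)" and \<theta>: "\<theta> \<in> carrier (H1_U Q)"
    and gen: "\<And>j k. j < d \<Longrightarrow> k < d \<Longrightarrow> \<eta> (au_gen Q j k) = \<theta> (au_gen Q j k)"
  shows "\<eta> = \<theta>"
proof (rule extensionalityI)
  show "\<eta> \<in> extensional (carrier (Au Q))" "\<theta> \<in> extensional (carrier (Au Q))"
    using \<eta> \<theta> by (simp_all add: H1_U_iff)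
  fix X assume "X \<in> carrier (Au Q)"
  then obtain x where x: "x \<in> carrier (free_ring d)" and X: "X = au_class Q x"
    by (auto simp: carrier_Au)
  from x have "\<eta> (au_class Q x) = \<theta> (au_class Q x)"
  proof (induction rule: free_ring_induct)
    case (scalar a)
    show ?case using H1_U_scalar[OF \<eta>] H1_U_scalar[OF \<theta>] by simp
  next
    case (gvar g)
    show ?case
    proof (cases g)
      case (U j k)
      then show ?thesis using gvar gen[of j k] by (simp add: au_gen_eq)
    next
      case (U_star j k)
      then show ?thesis
        using gvar gen[of k j] H1_U_relations(1)[OF \<eta>, of k j] H1_U_relations(1)[OF \<theta>, of k j]
        by simp
    qed
  qed (use \<eta> \<theta> in \<open>simp_all add: H1_U_iff\<close>)
  then show "\<eta> X = \<theta> X" by (simp add: X)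
qed

text \<open>Together with \<open>H1_U_eqI\<close> and \<open>H1_U_relations\<close>: cocycles correspond to the matrices that vanish
  between different weights.\<close>

lemma H1_U_exists:
  assumes "\<And>j k. j < d \<Longrightarrow> k < d \<Longrightarrow> p j \<noteq> p k \<Longrightarrow> A j k = 0"
  obtains \<eta> where "\<eta> \<in> carrier (H1_U Q)"
    "\<And>j k. j < d \<Longrightarrow> k < d \<Longrightarrow> \<eta> (au_gen Q j k) = A j k"
proof
  define D where "D = free_derivation A (\<lambda>j k. - A k j)"
  have D: "D x = D y" if "x - y \<in> au_ideal Q" for x y
    using derivation_vanishes(2)[OF _ that, of A "\<lambda>j k. - A k j"] assms
    by (auto simp: admissible_def D_def)
  have cl: "descend D (au_class Q x) = D x" if "x \<in> carrier (free_ring d)" for x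
    using that D by (rule descend_au_class)
  show "descend D \<in> carrier (H1_U Q)"
    by (auto simp: H1_U_iff cl) (simp_all add: D_def descend_def)
  show "descend D (au_gen Q j k) = A j k" if "j < d" "k < d" for j k
    using that by (simp add: au_gen_eq cl) (simp add: D_def)
qed

end

section \<open>Projections onto the blocks\<close>

lemma bij_betw_rank:
  assumes "finite (S :: nat set)"
  shows "bij_betw (\<lambda>j. card {l \<in> S. l < j}) S {..<card S}"
proof -
  have mono: "card {l \<in> S. l < j} < card {l \<in> S. l < k}" if "j \<in> S" "j < k" for j k
    by (rule psubset_card_mono) (use assms that in auto)
  have inj: "inj_on (\<lambda>j. card {l \<in> S. l < j}) S"
  proof (rule inj_onI)
    fix j k assume "j \<in> S" "k \<in> S" "card {l \<in> S. l < j} = card {l \<in> S. l < k}"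
    then show "j = k" using mono[of j k] mono[of k j] by (metis less_irrefl nat_neq_iff)
  qed
  moreover have "card {l \<in> S. l < j} < card S" if "j \<in> S" for j
    by (rule psubset_card_mono) (use assms that in auto)
  then have "(\<lambda>j. card {l \<in> S. l < j}) ` S \<subseteq> {..<card S}" by auto
  then have "(\<lambda>j. card {l \<in> S. l < j}) ` S = {..<card S}"
    by (intro card_subset_eq) (simp_all add: card_image[OF inj])
  ultimately show ?thesis by (simp add: bij_betw_def)
qed

context diag_weights
begin

lemma block_eq: "block Q c = {j. j < d \<and> p j = c}"
  by (auto simp: block_def Q_eq diag_of_def)

lemma finite_block [simp]: "finite (block Q c)"
  by (simp add: block_eq)

lemma bij_block_pos: "bij_betw (block_pos Q c) (block Q c) {..<card (block Q c)}"
  using bij_betw_rank[OF finite_block, of c] by (simp add: block_pos_def[abs_def])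

lemma block_pos_less: "j \<in> block Q c \<Longrightarrow> block_pos Q c j < card (block Q c)"
  using bij_betwE[OF bij_block_pos] by auto

lemma block_pos_eq_iff:
  "j \<in> block Q c \<Longrightarrow> k \<in> block Q c \<Longrightarrow> block_pos Q c j = block_pos Q c k \<longleftrightarrow> j = k"
  using bij_betw_imp_inj_on[OF bij_block_pos] by (auto dest: inj_onD)

text \<open>The matrix \<open>a\<close> placed in the block of \<open>c\<close>, completed by the identity matrix.\<close>

definition pad :: "complex \<Rightarrow> (nat \<Rightarrow> nat \<Rightarrow> free_alg) \<Rightarrow> nat \<Rightarrow> nat \<Rightarrow> free_alg" where
  "pad c a j k = (if j \<in> block Q c \<and> k \<in> block Q c then a (block_pos Q c j) (block_pos Q c k)
     else of_bool (j = k))"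

text \<open>Padding is multiplicative. The weights \<open>w\<close> are the ratios from the relators for \<open>Q\<close>; a nonzero
  term of the sum has \<open>j\<close>, \<open>l\<close> and \<open>k\<close> of equal weight, where these ratios are \<open>1\<close>.\<close>

lemma sum_pad:
  assumes jk: "j < d" "k < d"
    and w: "\<And>l. l < d \<Longrightarrow> p l = p j \<Longrightarrow> p l = p k \<Longrightarrow> w l = 1"
  shows "(\<Sum>l<d. w l * (pad c a j l * pad c b l k)) - of_bool (j = k) =
    (if j \<in> block Q c \<and> k \<in> block Q c
     then (\<Sum>l<card (block Q c). a (block_pos Q c j) l * b l (block_pos Q c k)) -
       of_bool (block_pos Q c j = block_pos Q c k)
     else 0)"
proof (cases "j \<in> block Q c \<and> k \<in> block Q c")
  case True
  have "(\<Sum>l<d. w l * (pad c a j l * pad c b l k)) =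
      (\<Sum>l\<in>block Q c. a (block_pos Q c j) (block_pos Q c l) * b (block_pos Q c l) (block_pos Q c k))"
  proof (rule sum.mono_neutral_cong_right)
    show "\<forall>l\<in>{..<d} - block Q c. w l * (pad c a j l * pad c b l k) = 0"
      using True by (auto simp: pad_def)
    fix l assume "l \<in> block Q c"
    moreover from this True have "w l = 1" by (intro w) (auto simp: block_eq)
    ultimately show "w l * (pad c a j l * pad c b l k) =
        a (block_pos Q c j) (block_pos Q c l) * b (block_pos Q c l) (block_pos Q c k)"
      using True by (simp add: pad_def)
  qed (auto simp: block_eq)
  also have "\<dots> = (\<Sum>l<card (block Q c). a (block_pos Q c j) l * b l (block_pos Q c k))"
    by (rule sum.reindex_bij_betw[OF bij_block_pos])
  finally show ?thesis using True by (simp add: block_pos_eq_iff)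
next
  case False
  have "w l * (pad c a j l * pad c b l k) = (if l = j then of_bool (j = k) else 0)" if "l < d" for l
    using False w[OF that] by (auto simp: pad_def block_eq)
  then have "(\<Sum>l<d. w l * (pad c a j l * pad c b l k)) =
      (\<Sum>l<d. if l = j then of_bool (j = k) else 0)"
    by (intro sum.cong) simp_all
  with False jk show ?thesis by auto
qed

fun pad_gen :: "complex \<Rightarrow> gen \<Rightarrow> free_alg" where
  "pad_gen c (U j k) = pad c (\<lambda>j k. gvar (U j k)) j k"
| "pad_gen c (U_star j k) = pad c (\<lambda>j k. gvar (U_star j k)) j k"

definition free_proj :: "complex \<Rightarrow> free_alg \<Rightarrow> free_alg" where
  "free_proj c = free_lift.free_eval (pad_gen c)"

lemma free_proj_simps [simp]:
  "free_proj c (x + y) = free_proj c x + free_proj c y"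
  "free_proj c (x - y) = free_proj c x - free_proj c y"
  "free_proj c (x * y) = free_proj c x * free_proj c y"
  "free_proj c (sum f L) = (\<Sum>l\<in>L. free_proj c (f l))"
  "free_proj c (scalar a) = scalar a" "free_proj c 0 = 0" "free_proj c 1 = 1"
  "free_proj c (gvar g) = pad_gen c g"
  by (simp_all add: free_proj_def free_lift.free_eval_simps)

lemma free_proj_of_bool [simp]: "free_proj c (of_bool P) = of_bool P"
  by (cases P) simp_all

lemma free_proj_closed:
  assumes "x \<in> carrier (free_ring d)"
  shows "free_proj c x \<in> carrier (free_ring (card (block Q c)))"
  using assms
proof (induction rule: free_ring_induct)
  case (gvar g)
  then show ?case by (cases g) (auto simp: pad_def block_pos_less)
qed simp_all

lemma free_proj_free_star: "free_proj c (free_star x) = free_star (free_proj c x)"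
proof (induction x rule: free_alg_induct)
  case (gvar g)
  then show ?case by (cases g) (auto simp: pad_def)
qed (simp_all add: free_star_add free_star_mult)

lemma free_counit_free_proj: "free_counit (free_proj c x) = free_counit x"
proof (induction x rule: free_alg_induct)
  case (gvar g)
  then show ?case by (cases g) (auto simp: pad_def block_pos_eq_iff)
qed simp_all

lemma pad_flip:
  "pad c a k j = pad c (\<lambda>k j. a j k) j k"
  by (auto simp: pad_def)

text \<open>On the block the relators for \<open>Q\<close> become those for the identity matrix, and elsewhere they
  become \<open>0\<close>.\<close>

lemma free_proj_relator:
  assumes "r \<in> free_relators d p" "m = card (block Q c)"
  shows "free_proj c r \<in> au_ideal (1\<^sub>m m)"
proof -
  interpret one: diag_weights "1\<^sub>m m" m "\<lambda>_. 1" by (rule diag_weights_one)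
  have mem: "(\<Sum>l<d. w l * (pad c a j l * pad c b l k)) - of_bool (j = k) \<in> au_ideal (1\<^sub>m m)"
    if jk: "j < d" "k < d" and w: "\<And>l. l < d \<Longrightarrow> p l = p j \<Longrightarrow> p l = p k \<Longrightarrow> w l = 1"
      and rel: "\<And>j k. j < m \<Longrightarrow> k < m \<Longrightarrow>
        (\<Sum>l<m. a j l * b l k) - of_bool (j = k) \<in> free_relators m (\<lambda>_. 1)"
    for w a b j k
  proof (cases "j \<in> block Q c \<and> k \<in> block Q c")
    case True
    then have "(\<Sum>l<m. a (block_pos Q c j) l * b l (block_pos Q c k)) -
        of_bool (block_pos Q c j = block_pos Q c k) \<in> au_ideal (1\<^sub>m m)"
      using one.relator_in_au_ideal[OF rel] block_pos_less assms(2) by blast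
    with True show ?thesis by (simp only: sum_pad[OF jk w] assms(2) if_True simp_thms)
  next
    case False
    then show ?thesis by (simp only: sum_pad[OF jk w] if_False one.au_ideal_closed(2))
  qed
  from assms(1) show ?thesis
  proof (cases rule: free_relators_cases)
    case (1 j k)
    have "free_proj c r = (\<Sum>l<d. 1 * (pad c (\<lambda>j l. gvar (U j l)) j l * pad c (\<lambda>l k. gvar (U_star k l)) l k))
        - of_bool (j = k)"
      using 1 by (simp add: pad_flip[of c _ k])
    also have "\<dots> \<in> au_ideal (1\<^sub>m m)"
      by (rule mem) (use 1 in \<open>auto simp: free_relators_def\<close>)
    finally show ?thesis .
  next
    case (2 j k)
    have "free_proj c r = (\<Sum>l<d. 1 * (pad c (\<lambda>j l. gvar (U_star l j)) j l * pad c (\<lambda>l k. gvar (U l k)) l k))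
        - of_bool (j = k)"
      using 2 by (simp add: pad_flip[of c _ _ j])
    also have "\<dots> \<in> au_ideal (1\<^sub>m m)"
      by (rule mem) (use 2 in \<open>auto simp: free_relators_def\<close>)
    finally show ?thesis .
  next
    case (3 j k)
    have "free_proj c r = (\<Sum>l<d. scalar (p l / p k) *
        (pad c (\<lambda>j l. gvar (U l j)) j l * pad c (\<lambda>l k. gvar (U_star l k)) l k)) - of_bool (j = k)"
      using 3 by (simp add: pad_flip[of c _ _ j])
    also have "\<dots> \<in> au_ideal (1\<^sub>m m)"
      by (rule mem) (use 3 weight_nonzero in \<open>auto simp: free_relators_def\<close>)
    finally show ?thesis .
  next
    case (4 j k)
    have "free_proj c r = (\<Sum>l<d. scalar (p j / p l) *
        (pad c (\<lambda>j l. gvar (U_star j l)) j l * pad c (\<lambda>l k. gvar (U k l)) l k)) - of_bool (j = k)"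
      using 4 by (simp add: pad_flip[of c _ k])
    also have "\<dots> \<in> au_ideal (1\<^sub>m m)"
      by (rule mem) (use 4 weight_nonzero in \<open>auto simp: free_relators_def\<close>)
    finally show ?thesis .
  qed
qed

lemma free_proj_au_ideal:
  assumes "x \<in> au_ideal Q" "m = card (block Q c)"
  shows "free_proj c x \<in> au_ideal (1\<^sub>m m)"
proof -
  interpret one: diag_weights "1\<^sub>m m" m "\<lambda>_. 1" by (rule diag_weights_one)
  have "ideal {x \<in> carrier (free_ring d). free_proj c x \<in> au_ideal (1\<^sub>m m)} (free_ring d)"
    using one.au_ideal_closed free_proj_closed[of _ c] assms(2)
    by (intro free_ring_idealI) auto
  then have "au_ideal Q \<subseteq> {x \<in> carrier (free_ring d). free_proj c x \<in> au_ideal (1\<^sub>m m)}"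
    using relator_in_au_ideal au_ideal_closed(1) free_proj_relator[OF _ assms(2)]
      one.au_ideal_free_star
    by (intro au_ideal_minimal) (auto simp: free_proj_free_star)
  with assms(1) show ?thesis by blast
qed

text \<open>Padding on the free algebra respects the ideals and so induces the projection.\<close>

lemma block_proj_au_class:
  assumes m: "m = card (block Q c)"
  shows "block_proj Q c m \<in> unital_star_hom (Au Q) (Au (1\<^sub>m m))"
    and "x \<in> carrier (free_ring d) \<Longrightarrow>
      block_proj Q c m (au_class Q x) = au_class (1\<^sub>m m) (free_proj c x)"
proof -
  interpret one: diag_weights "1\<^sub>m m" m "\<lambda>_. 1" by (rule diag_weights_one)
  have closed: "free_proj c x \<in> carrier (free_ring m)" if "x \<in> carrier (free_ring d)" for x
    using free_proj_closed[OF that] m by simp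
  have const: "au_class (1\<^sub>m m) (free_proj c x) = au_class (1\<^sub>m m) (free_proj c y)"
    if "x \<in> carrier (free_ring d)" "y \<in> carrier (free_ring d)" "x - y \<in> au_ideal Q" for x y
    using free_proj_au_ideal[OF that(3) m] closed that by (simp add: one.au_class_eq_iff)
  note rules = closed one.carrier_Au one.add_Au one.mult_Au one.smult_Au one.star_Au one.one_Au
    one.zero_Au one.au_gen_eq free_proj_free_star pad_def
  note hom = au_hom_au_class[where B = "Au (1\<^sub>m m)" and h = "\<lambda>x. au_class (1\<^sub>m m) (free_proj c x)"
      and b = "\<lambda>j k. if j \<in> block Q c \<and> k \<in> block Q c
            then au_gen (1\<^sub>m m) (block_pos Q c j) (block_pos Q c k)
            else if j = k then \<one>\<^bsub>Au (1\<^sub>m m)\<^esub> else \<zero>\<^bsub>Au (1\<^sub>m m)\<^esub>", folded block_proj_def]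
  show "block_proj Q c m \<in> unital_star_hom (Au Q) (Au (1\<^sub>m m))"
    by (rule hom(1)) (erule (2) const | (auto simp: rules)[1])+
  show "block_proj Q c m (au_class Q x) = au_class (1\<^sub>m m) (free_proj c x)"
    if "x \<in> carrier (free_ring d)"
    by (rule hom(2)[OF _ _ _ _ _ _ _ _ that]) (erule (2) const | (auto simp: rules)[1])+
qed

text \<open>Pulling back along the projection puts the matrix of a cocycle into the block and \<open>0\<close>
  elsewhere: the projection maps the generators off the block to scalars, where cocycles vanish.\<close>

lemma H1_U_pullback:
  assumes m: "m = card (block Q c)" and \<eta>: "\<eta> \<in> carrier (H1_U (1\<^sub>m m))"
  shows "compose (carrier (Au Q)) \<eta> (block_proj Q c m) \<in> carrier (H1_U Q)"
    and "j < d \<Longrightarrow> k < d \<Longrightarrow> compose (carrier (Au Q)) \<eta> (block_proj Q c m) (au_gen Q j k) =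
      (if j \<in> block Q c \<and> k \<in> block Q c
       then \<eta> (au_gen (1\<^sub>m m) (block_pos Q c j) (block_pos Q c k)) else 0)"
proof -
  interpret one: diag_weights "1\<^sub>m m" m "\<lambda>_. 1" by (rule diag_weights_one)
  have cl: "compose (carrier (Au Q)) \<eta> (block_proj Q c m) (au_class Q x) =
      \<eta> (au_class (1\<^sub>m m) (free_proj c x))" if "x \<in> carrier (free_ring d)" for x
    using that m by (simp add: compose_def block_proj_au_class carrier_Au)
  have closed: "free_proj c x \<in> carrier (free_ring m)" if "x \<in> carrier (free_ring d)" for x
    using free_proj_closed[OF that] m by simp
  show "compose (carrier (Au Q)) \<eta> (block_proj Q c m) \<in> carrier (H1_U Q)"
    unfolding H1_U_iff
  proof (intro conjI ballI allI)
    fix x y assume xy: "x \<in> carrier (free_ring d)" "y \<in> carrier (free_ring d)"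
    note hyps = \<eta>[unfolded one.H1_U_iff] closed[OF xy(1)] closed[OF xy(2)]
    show "compose (carrier (Au Q)) \<eta> (block_proj Q c m) (au_class Q (x + y)) =
        compose (carrier (Au Q)) \<eta> (block_proj Q c m) (au_class Q x) +
        compose (carrier (Au Q)) \<eta> (block_proj Q c m) (au_class Q y)"
      using hyps xy by (simp add: cl)
    show "compose (carrier (Au Q)) \<eta> (block_proj Q c m) (au_class Q (x * y)) =
        free_counit x * compose (carrier (Au Q)) \<eta> (block_proj Q c m) (au_class Q y) +
        compose (carrier (Au Q)) \<eta> (block_proj Q c m) (au_class Q x) * free_counit y"
      using hyps xy by (simp add: cl free_counit_free_proj)
  next
    fix a x assume x: "x \<in> carrier (free_ring d)"
    have "\<eta> (au_class (1\<^sub>m m) (scalar a * free_proj c x)) = a * \<eta> (au_class (1\<^sub>m m) (free_proj c x))"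
      using \<eta>[unfolded one.H1_U_iff] closed[OF x] by blast
    then show "compose (carrier (Au Q)) \<eta> (block_proj Q c m) (au_class Q (scalar a * x)) =
        a * compose (carrier (Au Q)) \<eta> (block_proj Q c m) (au_class Q x)"
      using x by (simp add: cl)
  qed (simp add: compose_def)
  have "\<eta> (au_class (1\<^sub>m m) (of_bool P)) = 0" for P
    using one.H1_U_scalar[OF \<eta>, of "of_bool P"] by (cases P) simp_all
  then show "compose (carrier (Au Q)) \<eta> (block_proj Q c m) (au_gen Q j k) =
      (if j \<in> block Q c \<and> k \<in> block Q c
       then \<eta> (au_gen (1\<^sub>m m) (block_pos Q c j) (block_pos Q c k)) else 0)"
    if "j < d" "k < d"
    using that by (simp add: au_gen_eq one.au_gen_eq cl pad_def)
qed

end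

section \<open>The complex vector space of cocycles\<close>

lemma field_class_ring: "field (class_ring :: complex ring)"
  by (rule class_field.field_axioms)

lemma H1_U_simps:
  "\<zero>\<^bsub>H1_U Q\<^esub> = (\<lambda>X\<in>carrier (Au Q). 0)"
  "\<eta> \<oplus>\<^bsub>H1_U Q\<^esub> \<theta> = (\<lambda>X\<in>carrier (Au Q). \<eta> X + \<theta> X)"
  "a \<odot>\<^bsub>H1_U Q\<^esub> \<eta> = (\<lambda>X\<in>carrier (Au Q). a * \<eta> X)"
  unfolding H1_U_def hochschild_H1_def ring.func_space_def[OF class_ring.ring_axioms]
  by simp_all

lemma (in diag_weights) vectorspace_H1_U: "vectorspace class_ring (H1_U Q)"
proof (rule vs_criteria[OF field_class_ring])
  have cl: "au_class Q x \<in> carrier (Au Q)" if "x \<in> carrier (free_ring d)" for x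
    using that by (simp add: carrier_Au)
  show "\<zero>\<^bsub>H1_U Q\<^esub> \<in> carrier (H1_U Q)"
    by (auto simp: H1_U_iff H1_U_simps cl)
  show "\<forall>\<eta> \<theta>. \<eta> \<in> carrier (H1_U Q) \<and> \<theta> \<in> carrier (H1_U Q) \<longrightarrow>
      \<eta> \<oplus>\<^bsub>H1_U Q\<^esub> \<theta> \<in> carrier (H1_U Q)"
    by (auto simp: H1_U_iff H1_U_simps cl algebra_simps)
  show sm: "\<forall>c \<eta>. c \<in> carrier class_ring \<and> \<eta> \<in> carrier (H1_U Q) \<longrightarrow>
      c \<odot>\<^bsub>H1_U Q\<^esub> \<eta> \<in> carrier (H1_U Q)"
    by (auto simp: H1_U_iff H1_U_simps cl algebra_simps)
  have ext: "\<eta> \<in> extensional (carrier (Au Q))" if "\<eta> \<in> carrier (H1_U Q)" for \<eta>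
    using that by (simp add: H1_U_iff)
  show "\<forall>\<eta>\<in>carrier (H1_U Q). \<exists>\<theta>\<in>carrier (H1_U Q). \<eta> \<oplus>\<^bsub>H1_U Q\<^esub> \<theta> = \<zero>\<^bsub>H1_U Q\<^esub>"
  proof
    fix \<eta> assume "\<eta> \<in> carrier (H1_U Q)"
    with sm have "(-1) \<odot>\<^bsub>H1_U Q\<^esub> \<eta> \<in> carrier (H1_U Q)" by simp
    then show "\<exists>\<theta>\<in>carrier (H1_U Q). \<eta> \<oplus>\<^bsub>H1_U Q\<^esub> \<theta> = \<zero>\<^bsub>H1_U Q\<^esub>"
      by (rule bexI[rotated]) (auto simp: H1_U_simps)
  qed
qed (auto simp: H1_U_simps algebra_simps fun_eq_iff restrict_def extensional_def H1_U_iff)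

lemma (in diag_weights) finsum_H1_U:
  assumes "finite I" "f \<in> I \<rightarrow> carrier (H1_U Q)" "X \<in> carrier (Au Q)"
  shows "(\<Oplus>\<^bsub>H1_U Q\<^esub>i\<in>I. f i) X = (\<Sum>i\<in>I. f i X)"
proof -
  interpret vectorspace class_ring "H1_U Q" by (rule vectorspace_H1_U)
  show ?thesis using assms
  proof (induction I)
    case empty
    then show ?case by (simp add: H1_U_simps)
  next
    case (insert i I)
    then show ?case by (subst M.finsum_insert) (auto simp: H1_U_simps Pi_def)
  qed
qed

lemma vectorspace_direct_sum:
  assumes "\<And>i. i \<in> I \<Longrightarrow> vectorspace class_ring (M i)"
  shows "vectorspace class_ring (direct_sum_module I M)"
proof -
  have M: "abelian_group (M i)" "Module.module class_ring (M i)" if "i \<in> I" for i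
    using assms[OF that] by (auto simp: vectorspace_def Module.module_def)
  note ag = abelian_group.axioms(1)[OF M(1)]
  show ?thesis
  proof (rule vs_criteria[OF field_class_ring])
    show "\<forall>v\<in>carrier (direct_sum_module I M). \<exists>w\<in>carrier (direct_sum_module I M).
        v \<oplus>\<^bsub>direct_sum_module I M\<^esub> w = \<zero>\<^bsub>direct_sum_module I M\<^esub>"
    proof
      fix v assume v: "v \<in> carrier (direct_sum_module I M)"
      show "\<exists>w\<in>carrier (direct_sum_module I M).
          v \<oplus>\<^bsub>direct_sum_module I M\<^esub> w = \<zero>\<^bsub>direct_sum_module I M\<^esub>"
        by (rule bexI[of _ "\<lambda>i\<in>I. \<ominus>\<^bsub>M i\<^esub> v i"])
           (use v M in \<open>auto simp: direct_sum_module_def PiE_iff abelian_group.r_neg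
             abelian_group.a_inv_closed fun_eq_iff\<close>)
    qed
  qed (use M ag in \<open>auto simp: direct_sum_module_def PiE_iff fun_eq_iff extensional_def
      abelian_monoid.a_closed abelian_monoid.a_assoc abelian_monoid.a_comm abelian_monoid.a_lcomm abelian_monoid.r_zero
      abelian_monoid.zero_closed module.smult_closed[where R = class_ring, simplified] module.smult_assoc1[where R = class_ring, simplified]
      module.smult_l_distr[where R = class_ring, simplified] module.smult_r_distr[where R = class_ring, simplified]
      module.smult_one[where R = class_ring, simplified]\<close>)
qed

section \<open>The multiplicity of an eigenvalue\<close>

text \<open>The unit vectors at the zeros on the diagonal form a basis of the kernel.\<close>

lemma kernel_dim_diag_of: "kernel_dim (diag_of d r) = card {j. j < d \<and> r j = 0}"
proof -
  interpret kernel d d "diag_of d r" by standard simp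
  define J where "J = {j. j < d \<and> r j = 0}"
  define S where "S = (unit_vec d :: nat \<Rightarrow> complex vec) ` J"
  have mult: "(diag_of d r *\<^sub>v v) $ j = r j * v $ j" if "v \<in> carrier_vec d" "j < d" for v j
  proof -
    have "(diag_of d r *\<^sub>v v) $ j = (\<Sum>l\<in>{0..<d}. (if j = l then r j else 0) * v $ l)"
      using that by (simp add: diag_of_def scalar_prod_def)
    also have "\<dots> = (\<Sum>l\<in>{0..<d}. if l = j then r j * v $ j else 0)"
      by (rule sum.cong) auto
    finally show ?thesis using that by simp
  qed
  have mem: "v \<in> mat_kernel (diag_of d r) \<longleftrightarrow> v \<in> carrier_vec d \<and> (\<forall>j<d. r j * v $ j = 0)" for v
    unfolding mat_kernel[OF diag_of_carrier] using mult[of v] by (auto simp: vec_eq_iff)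
  have fin: "finite J" "finite S" by (simp_all add: J_def S_def)
  have sub: "S \<subseteq> mat_kernel (diag_of d r)"
    by (auto simp: S_def J_def mem unit_vec_def)
  have inj: "inj_on (unit_vec d :: nat \<Rightarrow> complex vec) J"
    by (rule inj_onI) (auto simp: J_def unit_vec_eq)
  have coeff: "lincomb a S $ j = (if j \<in> J then a (unit_vec d j) else 0)" if "j < d" for a j
  proof -
    have "lincomb a S $ j = (\<Sum>u\<in>S. a u * u $ j)"
      by (rule lincomb_index[OF that sub])
    also have "\<dots> = (\<Sum>l\<in>J. a (unit_vec d l) * unit_vec d l $ j)"
      unfolding S_def by (rule sum.reindex[OF inj, unfolded o_def])
    also have "\<dots> = (\<Sum>l\<in>J. if l = j then a (unit_vec d j) else 0)"
      by (rule sum.cong) (use that in \<open>auto simp: J_def unit_vec_def\<close>)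
    finally show ?thesis using fin by simp
  qed
  have "basis S"
    unfolding Ker.basis_def
  proof (intro conjI)
    show "Ker.lin_indpt S"
    proof (rule Ker.finite_lin_indpt2[OF fin(2) sub])
      fix a :: "complex vec \<Rightarrow> complex"
      assume zero: "lincomb a S = 0\<^sub>v d"
      show "\<forall>v\<in>S. a v = 0"
      proof
        fix v assume "v \<in> S"
        then obtain j where "j \<in> J" "v = unit_vec d j" by (auto simp: S_def)
        then show "a v = 0" using coeff[of j a] unfolding zero by (simp add: J_def)
      qed
    qed
    show "Ker.span S = mat_kernel (diag_of d r)"
    proof
      show "Ker.span S \<subseteq> mat_kernel (diag_of d r)" by (rule Ker.span_is_subset2[OF sub])
      show "mat_kernel (diag_of d r) \<subseteq> Ker.span S"
      proof
        fix v assume v: "v \<in> mat_kernel (diag_of d r)"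
        \<comment> \<open>The coefficient of the \<open>j\<close>-th unit vector is the \<open>j\<close>-th entry of \<open>v\<close>.\<close>
        define a :: "complex vec \<Rightarrow> complex" where "a = (\<lambda>u. v $ (THE j. j \<in> J \<and> unit_vec d j = u))"
        have a: "a (unit_vec d j) = v $ j" if "j \<in> J" for j
        proof -
          have "(THE l. l \<in> J \<and> unit_vec d l = (unit_vec d j :: complex vec)) = j"
            using that inj by (intro the_equality) (auto dest: inj_onD)
          then show ?thesis by (simp only: a_def)
        qed
        have "lincomb a S \<in> mat_kernel (diag_of d r)" using Ker.lincomb_closed[OF sub] by simp
        then have "v = lincomb a S"
          using v by (intro eq_vecI) (auto simp: mem coeff a J_def)
        then show "v \<in> Ker.span S" unfolding Ker.finite_span[OF fin(2) sub] by auto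
      qed
    qed
    show "S \<subseteq> mat_kernel (diag_of d r)" by (rule sub)
  qed
  from Ker.dim_basis[OF fin(2) this] show ?thesis
    by (simp add: S_def card_image[OF inj]) (simp add: J_def)
qed

lemma char_matrix_diag_of: "char_matrix (diag_of d p) c = diag_of d (\<lambda>j. p j - c)"
  by (rule eq_matI) (auto simp: char_matrix_def diag_of_def)

lemma eigenvalue_diag_of:
  assumes "j < d"
  shows "eigenvalue (diag_of d p) (p j)"
proof -
  have "diag_of d p *\<^sub>v unit_vec d j = p j \<cdot>\<^sub>v unit_vec d j"
    using assms by (intro eq_vecI) (auto simp: diag_of_def)
  then show ?thesis
    using assms by (auto simp: eigenvalue_def eigenvector_def intro!: exI[of _ "unit_vec d j"])
qed

section \<open>Decomposition of the first cohomology\<close>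

lemma linear_mapI:
  assumes "vectorspace class_ring V" "vectorspace class_ring W"
    and "\<And>v. v \<in> carrier V \<Longrightarrow> T v \<in> carrier W"
    and "\<And>v w. v \<in> carrier V \<Longrightarrow> w \<in> carrier V \<Longrightarrow> T (v \<oplus>\<^bsub>V\<^esub> w) = T v \<oplus>\<^bsub>W\<^esub> T w"
    and "\<And>a v. v \<in> carrier V \<Longrightarrow> T (a \<odot>\<^bsub>V\<^esub> v) = a \<odot>\<^bsub>W\<^esub> T v"
  shows "linear_map class_ring V W T"
  using assms by (simp add: linear_map_def mod_hom_def mod_hom_axioms_def
      LinearCombinations.module_hom_def vectorspace_def)

lemma linear_mapD:
  assumes "linear_map class_ring V W T"
  shows "vectorspace class_ring V" "vectorspace class_ring W"
    and "v \<in> carrier V \<Longrightarrow> T v \<in> carrier W"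
    and "v \<in> carrier V \<Longrightarrow> w \<in> carrier V \<Longrightarrow> T (v \<oplus>\<^bsub>V\<^esub> w) = T v \<oplus>\<^bsub>W\<^esub> T w"
    and "v \<in> carrier V \<Longrightarrow> T (a \<odot>\<^bsub>V\<^esub> v) = a \<odot>\<^bsub>W\<^esub> T v"
  using assms by (auto simp: linear_map_def mod_hom_def mod_hom_axioms_def
      LinearCombinations.module_hom_def)

lemma direct_sum_simps:
  "carrier (direct_sum_module I M) = (\<Pi>\<^sub>E i\<in>I. carrier (M i))"
  "v \<oplus>\<^bsub>direct_sum_module I M\<^esub> w = (\<lambda>i\<in>I. v i \<oplus>\<^bsub>M i\<^esub> w i)"
  "a \<odot>\<^bsub>direct_sum_module I M\<^esub> v = (\<lambda>i\<in>I. a \<odot>\<^bsub>M i\<^esub> v i)"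
  by (simp_all add: direct_sum_module_def)

lemma linear_map_direct_sum:
  assumes I: "finite I" and W: "vectorspace class_ring W"
    and T: "\<And>i. i \<in> I \<Longrightarrow> linear_map class_ring (V i) W (T i)"
  shows "linear_map class_ring (direct_sum_module I V) W (\<lambda>v. \<Oplus>\<^bsub>W\<^esub>i\<in>I. T i (v i))"
proof (rule linear_mapI[OF _ W])
  interpret W: vectorspace class_ring W by (rule W)
  show "vectorspace class_ring (direct_sum_module I V)"
    by (rule vectorspace_direct_sum) (rule linear_mapD(1)[OF T])
  have mem: "(\<lambda>i. T i (v i)) \<in> I \<rightarrow> carrier W" if "v \<in> carrier (direct_sum_module I V)" for v
    using that linear_mapD(3)[OF T] by (auto simp: direct_sum_simps)
  show "(\<Oplus>\<^bsub>W\<^esub>i\<in>I. T i (v i)) \<in> carrier W" if "v \<in> carrier (direct_sum_module I V)" for v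
    by (rule W.finsum_closed[OF mem[OF that]])
  show "(\<Oplus>\<^bsub>W\<^esub>i\<in>I. T i ((v \<oplus>\<^bsub>direct_sum_module I V\<^esub> w) i)) =
      (\<Oplus>\<^bsub>W\<^esub>i\<in>I. T i (v i)) \<oplus>\<^bsub>W\<^esub> (\<Oplus>\<^bsub>W\<^esub>i\<in>I. T i (w i))"
    if v: "v \<in> carrier (direct_sum_module I V)" and w: "w \<in> carrier (direct_sum_module I V)" for v w
  proof -
    have "(\<Oplus>\<^bsub>W\<^esub>i\<in>I. T i ((v \<oplus>\<^bsub>direct_sum_module I V\<^esub> w) i)) =
        (\<Oplus>\<^bsub>W\<^esub>i\<in>I. T i (v i) \<oplus>\<^bsub>W\<^esub> T i (w i))"
      by (rule W.finsum_cong')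
         (use v w mem[OF v] mem[OF w] linear_mapD(4)[OF T] in \<open>auto simp: direct_sum_simps PiE_iff\<close>)
    then show ?thesis by (simp only: W.finsum_addf[OF mem[OF v] mem[OF w]])
  qed
  show "(\<Oplus>\<^bsub>W\<^esub>i\<in>I. T i ((a \<odot>\<^bsub>direct_sum_module I V\<^esub> v) i)) = a \<odot>\<^bsub>W\<^esub> (\<Oplus>\<^bsub>W\<^esub>i\<in>I. T i (v i))"
    if v: "v \<in> carrier (direct_sum_module I V)" for a v
  proof -
    have "(\<Oplus>\<^bsub>W\<^esub>i\<in>I. T i ((a \<odot>\<^bsub>direct_sum_module I V\<^esub> v) i)) = (\<Oplus>\<^bsub>W\<^esub>i\<in>I. a \<odot>\<^bsub>W\<^esub> T i (v i))"
      by (rule W.finsum_cong')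
         (use v mem[OF v] linear_mapD(5)[OF T] W.smult_closed in \<open>auto simp: direct_sum_simps PiE_iff\<close>)
    then show ?thesis using W.finsum_smult[OF _ mem[OF v], of a] by simp
  qed
qed

lemma linear_iso_direct_sum:
  assumes T: "\<And>i. i \<in> I \<Longrightarrow> linear_iso (V i) (W i) (T i)"
  shows "linear_iso (direct_sum_module I V) (direct_sum_module I W) (\<lambda>v. \<lambda>i\<in>I. T i (v i))"
  unfolding linear_iso_def
proof
  have lin: "linear_map class_ring (V i) (W i) (T i)"
    and bij: "bij_betw (T i) (carrier (V i)) (carrier (W i))" if "i \<in> I" for i
    using T[OF that] by (simp_all add: linear_iso_def)
  show "linear_map class_ring (direct_sum_module I V) (direct_sum_module I W) (\<lambda>v. \<lambda>i\<in>I. T i (v i))"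
  proof (rule linear_mapI)
    show "vectorspace class_ring (direct_sum_module I V)"
      by (rule vectorspace_direct_sum) (rule linear_mapD(1)[OF lin])
    show "vectorspace class_ring (direct_sum_module I W)"
      by (rule vectorspace_direct_sum) (rule linear_mapD(2)[OF lin])
  qed (use linear_mapD(3-5)[OF lin] in \<open>auto simp: direct_sum_simps PiE_iff fun_eq_iff\<close>)
  show "bij_betw (\<lambda>v. \<lambda>i\<in>I. T i (v i)) (carrier (direct_sum_module I V)) (carrier (direct_sum_module I W))"
  proof (rule bij_betw_byWitness[where f' = "\<lambda>w. \<lambda>i\<in>I. inv_into (carrier (V i)) (T i) (w i)"])
    show "\<forall>v\<in>carrier (direct_sum_module I V).
        (\<lambda>i\<in>I. inv_into (carrier (V i)) (T i) ((\<lambda>i\<in>I. T i (v i)) i)) = v"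
      by (auto simp: direct_sum_simps PiE_iff fun_eq_iff extensional_def bij_betw_inv_into_left[OF bij])
    show "\<forall>w\<in>carrier (direct_sum_module I W).
        (\<lambda>i\<in>I. T i ((\<lambda>i\<in>I. inv_into (carrier (V i)) (T i) (w i)) i)) = w"
      by (auto simp: direct_sum_simps PiE_iff fun_eq_iff extensional_def bij_betw_inv_into_right[OF bij])
    show "(\<lambda>v. \<lambda>i\<in>I. T i (v i)) ` carrier (direct_sum_module I V) \<subseteq> carrier (direct_sum_module I W)"
      using linear_mapD(3)[OF lin] by (auto simp: direct_sum_simps PiE_iff)
    show "(\<lambda>w. \<lambda>i\<in>I. inv_into (carrier (V i)) (T i) (w i)) ` carrier (direct_sum_module I W)
        \<subseteq> carrier (direct_sum_module I V)"
      using bij_betwE[OF bij_betw_inv_into[OF bij]] by (auto simp: direct_sum_simps PiE_iff)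
  qed
qed

lemma (in diag_weights) au_gen_closed: "j < d \<Longrightarrow> k < d \<Longrightarrow> au_gen Q j k \<in> carrier (Au Q)"
  by (simp add: au_gen_eq carrier_Au)

text \<open>All weights of the identity matrix agree, so every matrix is the matrix of a unique cocycle.\<close>

lemma linear_iso_H1_U_one:
  "linear_iso (H1_U (1\<^sub>m m)) (module_mat TYPE(complex) m m)
    (\<lambda>\<eta>. mat m m (\<lambda>(j, k). \<eta> (au_gen (1\<^sub>m m) j k)))"
  unfolding linear_iso_def
proof
  interpret one: diag_weights "1\<^sub>m m" m "\<lambda>_. 1" by (rule diag_weights_one)
  show "linear_map class_ring (H1_U (1\<^sub>m m)) (module_mat TYPE(complex) m m)
      (\<lambda>\<eta>. mat m m (\<lambda>(j, k). \<eta> (au_gen (1\<^sub>m m) j k)))"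
    by (rule linear_mapI[OF one.vectorspace_H1_U matrix_vs])
       (auto simp: module_mat_simps H1_U_simps one.au_gen_closed intro!: eq_matI)
  show "bij_betw (\<lambda>\<eta>. mat m m (\<lambda>(j, k). \<eta> (au_gen (1\<^sub>m m) j k)))
      (carrier (H1_U (1\<^sub>m m))) (carrier (module_mat TYPE(complex) m m))"
  proof (rule bij_betw_imageI)
    show "inj_on (\<lambda>\<eta>. mat m m (\<lambda>(j, k). \<eta> (au_gen (1\<^sub>m m) j k))) (carrier (H1_U (1\<^sub>m m)))"
    proof (rule inj_onI)
      fix \<eta> \<theta>
      assume \<eta>: "\<eta> \<in> carrier (H1_U (1\<^sub>m m))" and \<theta>: "\<theta> \<in> carrier (H1_U (1\<^sub>m m))"
        and eq: "mat m m (\<lambda>(j, k). \<eta> (au_gen (1\<^sub>m m) j k)) = mat m m (\<lambda>(j, k). \<theta> (au_gen (1\<^sub>m m) j k))"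
      show "\<eta> = \<theta>"
      proof (rule one.H1_U_eqI[OF \<eta> \<theta>])
        fix j k assume "j < m" "k < m"
        then show "\<eta> (au_gen (1\<^sub>m m) j k) = \<theta> (au_gen (1\<^sub>m m) j k)"
          using arg_cong[OF eq, of "\<lambda>M. M $$ (j, k)"] by simp
      qed
    qed
    show "(\<lambda>\<eta>. mat m m (\<lambda>(j, k). \<eta> (au_gen (1\<^sub>m m) j k))) ` carrier (H1_U (1\<^sub>m m)) =
        carrier (module_mat TYPE(complex) m m)"
    proof
      show "carrier (module_mat TYPE(complex) m m) \<subseteq>
          (\<lambda>\<eta>. mat m m (\<lambda>(j, k). \<eta> (au_gen (1\<^sub>m m) j k))) ` carrier (H1_U (1\<^sub>m m))"
      proof
        fix M assume "M \<in> carrier (module_mat TYPE(complex) m m)"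
        then have M: "M \<in> carrier_mat m m" by (simp add: module_mat_simps)
        obtain \<eta> where \<eta>: "\<eta> \<in> carrier (H1_U (1\<^sub>m m))"
          "\<And>j k. j < m \<Longrightarrow> k < m \<Longrightarrow> \<eta> (au_gen (1\<^sub>m m) j k) = M $$ (j, k)"
          using one.H1_U_exists[of "\<lambda>j k. M $$ (j, k)"] by auto
        have "M = mat m m (\<lambda>(j, k). \<eta> (au_gen (1\<^sub>m m) j k))"
          using M by (intro eq_matI) (auto simp: \<eta>(2))
        with \<eta>(1) show "M \<in> (\<lambda>\<eta>. mat m m (\<lambda>(j, k). \<eta> (au_gen (1\<^sub>m m) j k))) ` carrier (H1_U (1\<^sub>m m))"
          by blast
      qed
    qed (auto simp: module_mat_simps)
  qed
qed

lemma (in diag_weights) linear_map_pullback: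
  assumes m: "m = card (block Q c)"
  shows "linear_map class_ring (H1_U (1\<^sub>m m)) (H1_U Q)
    (\<lambda>\<eta>. compose (carrier (Au Q)) \<eta> (block_proj Q c m))"
proof -
  interpret one: diag_weights "1\<^sub>m m" m "\<lambda>_. 1" by (rule diag_weights_one)
  have "free_proj c x \<in> carrier (free_ring m)" if "x \<in> carrier (free_ring d)" for x
    using free_proj_closed[OF that] m by simp
  then have closed: "block_proj Q c m X \<in> carrier (Au (1\<^sub>m m))" if "X \<in> carrier (Au Q)" for X
    using that by (auto simp: carrier_Au one.carrier_Au block_proj_au_class[OF m])
  show ?thesis
    by (rule linear_mapI[OF one.vectorspace_H1_U vectorspace_H1_U H1_U_pullback(1)[OF m]])
       (auto simp: H1_U_simps compose_def closed fun_eq_iff restrict_def)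
qed

text \<open>On the level of matrices, the map assembles a matrix from its diagonal blocks. Its image
  consists of all matrices that vanish between different weights, and these are the matrices of
  cocycles.\<close>

lemma (in diag_weights) linear_iso_pullback:
  fixes q :: "nat \<Rightarrow> complex" and e :: "nat \<Rightarrow> nat"
  assumes inj: "inj_on q {..<n}" and q: "\<And>j. j < d \<Longrightarrow> \<exists>i<n. p j = q i"
    and e: "\<And>i. i < n \<Longrightarrow> e i = card (block Q (q i))"
  shows "linear_iso (direct_sum_module {..<n} (\<lambda>i. H1_U (1\<^sub>m (e i)))) (H1_U Q)
    (\<lambda>\<eta>. \<Oplus>\<^bsub>H1_U Q\<^esub>i\<in>{..<n}. compose (carrier (Au Q)) (\<eta> i) (block_proj Q (q i) (e i)))"
    (is "linear_iso ?V _ ?T")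
  unfolding linear_iso_def
proof
  have one: "diag_weights (1\<^sub>m (e i)) (e i) (\<lambda>_. 1)" for i by (rule diag_weights_one)
  show lin: "linear_map class_ring ?V (H1_U Q) ?T"
    by (rule linear_map_direct_sum[OF finite_lessThan vectorspace_H1_U,
          where T = "\<lambda>i \<theta>. compose (carrier (Au Q)) \<theta> (block_proj Q (q i) (e i))"]) (simp add: linear_map_pullback e)
  have mem: "\<eta> i \<in> carrier (H1_U (1\<^sub>m (e i)))" if "\<eta> \<in> carrier ?V" "i < n" for \<eta> i
    using that by (auto simp: direct_sum_simps)
  have T_gen: "?T \<eta> (au_gen Q j k) = (\<Sum>i<n. if j \<in> block Q (q i) \<and> k \<in> block Q (q i)
      then \<eta> i (au_gen (1\<^sub>m (e i)) (block_pos Q (q i) j) (block_pos Q (q i) k)) else 0)"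
    if \<eta>: "\<eta> \<in> carrier ?V" and jk: "j < d" "k < d" for \<eta> j k
  proof -
    have "?T \<eta> (au_gen Q j k) =
        (\<Sum>i<n. compose (carrier (Au Q)) (\<eta> i) (block_proj Q (q i) (e i)) (au_gen Q j k))"
      using H1_U_pullback(1)[OF e mem[OF \<eta>]] jk by (intro finsum_H1_U) (auto intro: au_gen_closed)
    also have "\<dots> = (\<Sum>i<n. if j \<in> block Q (q i) \<and> k \<in> block Q (q i)
        then \<eta> i (au_gen (1\<^sub>m (e i)) (block_pos Q (q i) j) (block_pos Q (q i) k)) else 0)"
      by (rule sum.cong) (simp_all add: H1_U_pullback(2)[OF e mem[OF \<eta>] jk])
    finally show ?thesis .
  qed
  have T_same: "?T \<eta> (au_gen Q j k) =
      \<eta> i (au_gen (1\<^sub>m (e i)) (block_pos Q (q i) j) (block_pos Q (q i) k))"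
    if \<eta>: "\<eta> \<in> carrier ?V" and i: "i < n" and jk: "j \<in> block Q (q i)" "k \<in> block Q (q i)" for \<eta> i j k
  proof -
    have "(\<Sum>h<n. if j \<in> block Q (q h) \<and> k \<in> block Q (q h)
        then \<eta> h (au_gen (1\<^sub>m (e h)) (block_pos Q (q h) j) (block_pos Q (q h) k)) else 0) =
      (\<Sum>h<n. if h = i
        then \<eta> i (au_gen (1\<^sub>m (e i)) (block_pos Q (q i) j) (block_pos Q (q i) k)) else 0)"
      using jk i inj by (intro sum.cong) (auto simp: block_eq dest: inj_onD)
    then show ?thesis using T_gen[OF \<eta>, of j k] jk i by (simp add: block_eq)
  qed
  have T_diff: "?T \<eta> (au_gen Q j k) = 0"
    if \<eta>: "\<eta> \<in> carrier ?V" and jk: "j < d" "k < d" "p j \<noteq> p k" for \<eta> j k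
    unfolding T_gen[OF \<eta> jk(1,2)] using jk by (intro sum.neutral) (auto simp: block_eq)
  show "bij_betw ?T (carrier ?V) (carrier (H1_U Q))"
  proof (rule bij_betw_imageI)
    show "inj_on ?T (carrier ?V)"
    proof (rule inj_onI)
      fix \<eta> \<theta> assume \<eta>: "\<eta> \<in> carrier ?V" and \<theta>: "\<theta> \<in> carrier ?V" and eq: "?T \<eta> = ?T \<theta>"
      have "\<eta> i = \<theta> i" if i: "i < n" for i
      proof (rule diag_weights.H1_U_eqI[OF one mem[OF \<eta> i] mem[OF \<theta> i]])
        fix j k assume jk: "j < e i" "k < e i"
        have "block_pos Q (q i) ` block Q (q i) = {..<e i}"
          using bij_betw_imp_surj_on[OF bij_block_pos] e[OF i] by simp
        with jk obtain j' k' where "j' \<in> block Q (q i)" "k' \<in> block Q (q i)"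
          "j = block_pos Q (q i) j'" "k = block_pos Q (q i) k'"
          by (metis imageE lessThan_iff)
        then show "\<eta> i (au_gen (1\<^sub>m (e i)) j k) = \<theta> i (au_gen (1\<^sub>m (e i)) j k)"
          using T_same[OF \<eta> i, of j' k'] T_same[OF \<theta> i, of j' k'] eq by simp
      qed
      with \<eta> \<theta> show "\<eta> = \<theta>"
        unfolding direct_sum_simps by (auto intro: PiE_ext)
    qed
    show "?T ` carrier ?V = carrier (H1_U Q)"
    proof
      show "?T ` carrier ?V \<subseteq> carrier (H1_U Q)" using linear_mapD(3)[OF lin] by blast
      show "carrier (H1_U Q) \<subseteq> ?T ` carrier ?V"
      proof
        fix \<zeta> assume \<zeta>: "\<zeta> \<in> carrier (H1_U Q)"
        \<comment> \<open>The preimage in the block of a position in the small matrix.\<close>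
        define idx where "idx = (\<lambda>i. inv_into (block Q (q i)) (block_pos Q (q i)))"
        have "\<exists>\<theta>. \<theta> \<in> carrier (H1_U (1\<^sub>m (e i))) \<and>
            (\<forall>j<e i. \<forall>k<e i. \<theta> (au_gen (1\<^sub>m (e i)) j k) = \<zeta> (au_gen Q (idx i j) (idx i k)))" for i
          by (rule diag_weights.H1_U_exists[OF one, of i "\<lambda>j k. \<zeta> (au_gen Q (idx i j) (idx i k))"])
             auto
        then obtain \<theta> where \<theta>: "\<And>i. \<theta> i \<in> carrier (H1_U (1\<^sub>m (e i)))"
          "\<And>i j k. j < e i \<Longrightarrow> k < e i \<Longrightarrow>
            \<theta> i (au_gen (1\<^sub>m (e i)) j k) = \<zeta> (au_gen Q (idx i j) (idx i k))"
          by metis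
        define \<eta> where "\<eta> = (\<lambda>i\<in>{..<n}. \<theta> i)"
        have \<eta>: "\<eta> \<in> carrier ?V" using \<theta>(1) by (auto simp: \<eta>_def direct_sum_simps)
        have "?T \<eta> = \<zeta>"
        proof (rule H1_U_eqI[OF linear_mapD(3)[OF lin \<eta>] \<zeta>])
          fix j k assume jk: "j < d" "k < d"
          show "?T \<eta> (au_gen Q j k) = \<zeta> (au_gen Q j k)"
          proof (cases "p j = p k")
            case True
            obtain i where i: "i < n" "p j = q i" using q[OF jk(1)] by blast
            with True jk have blk: "j \<in> block Q (q i)" "k \<in> block Q (q i)" by (auto simp: block_eq)
            then have "idx i (block_pos Q (q i) j) = j" "idx i (block_pos Q (q i) k) = k"
              using bij_block_pos[of "q i"] by (simp_all add: idx_def bij_betw_inv_into_left)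
            then show ?thesis
              unfolding T_same[OF \<eta> i(1) blk]
              using \<theta>(2)[of "block_pos Q (q i) j" i "block_pos Q (q i) k"]
                block_pos_less[OF blk(1)] block_pos_less[OF blk(2)] i e
              by (simp add: \<eta>_def)
          next
            case False
            then show ?thesis using T_diff[OF \<eta> jk] H1_U_relations(2)[OF \<zeta> jk] by simp
          qed
        qed
        with \<eta> show "\<zeta> \<in> ?T ` carrier ?V" by blast
      qed
    qed
  qed
qed

text \<open>The quadratic form of \<open>Q\<close> at a unit vector is a diagonal entry.\<close>

lemma strictly_positive_diagonal:
  assumes "strictly_positive d Q" "diagonal_mat Q"
  shows "diag_weights Q d (\<lambda>j. Q $$ (j, j))"
proof
  from assms have Q: "Q \<in> carrier_mat d d" by (simp add: strictly_positive_def)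
  with assms(2) show "Q = diag_of d (\<lambda>j. Q $$ (j, j))"
    by (intro eq_matI) (auto simp: diag_of_def diagonal_mat_def)
  fix j assume j: "j < d"
  have "0 < (Q *\<^sub>v unit_vec d j) \<bullet>c unit_vec d j"
    using assms(1) j by (auto simp: strictly_positive_def)
  also have "conjugate (unit_vec d j) = (unit_vec d j :: complex vec)"
    by (rule eq_vecI) (auto simp: unit_vec_def)
  also have "(Q *\<^sub>v unit_vec d j) \<bullet> unit_vec d j = Q $$ (j, j)"
    using Q j by simp
  finally show "Q $$ (j, j) \<noteq> 0" by auto
qed

theorem proposition3p2:
  fixes Q :: "complex mat" and d n :: nat
    and q :: "nat \<Rightarrow> complex" and e :: "nat \<Rightarrow> nat"
  assumes "strictly_positive d Q"
    and "diagonal_mat Q"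
    and "bij_betw q {..<n} {c. eigenvalue Q c}"
    and "\<And>i. i < n \<Longrightarrow> e i = kernel_dim (char_matrix Q (q i))"
  shows "(\<forall>i<n. linear_map class_ring (H1_U (1\<^sub>m (e i))) (H1_U Q)
            (\<lambda>\<eta>. compose (carrier (Au Q)) \<eta> (block_proj Q (q i) (e i)))) \<and>
    linear_iso (direct_sum_module {..<n} (\<lambda>i. H1_U (1\<^sub>m (e i)))) (H1_U Q)
      (\<lambda>\<eta>. \<Oplus>\<^bsub>H1_U Q\<^esub>i\<in>{..<n}.
              compose (carrier (Au Q)) (\<eta> i) (block_proj Q (q i) (e i))) \<and>
    (\<exists>T. linear_iso (direct_sum_module {..<n} (\<lambda>i. H1_U (1\<^sub>m (e i))))
           (direct_sum_module {..<n} (\<lambda>i. module_mat TYPE(complex) (e i) (e i))) T)"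
proof -
  define p where "p = (\<lambda>j. Q $$ (j, j))"
  interpret diag_weights Q d p
    unfolding p_def by (rule strictly_positive_diagonal[OF assms(1,2)])
  have e: "e i = card (block Q (q i))" if "i < n" for i
    unfolding assms(4)[OF that] block_eq
    by (subst Q_eq) (simp add: char_matrix_diag_of kernel_dim_diag_of)
  have "\<exists>i<n. p j = q i" if "j < d" for j
  proof -
    have "p j \<in> q ` {..<n}"
      using bij_betw_imp_surj_on[OF assms(3)] eigenvalue_diag_of[OF that, of p] Q_eq by simp
    then show ?thesis by auto
  qed
  then have "linear_iso (direct_sum_module {..<n} (\<lambda>i. H1_U (1\<^sub>m (e i)))) (H1_U Q)
      (\<lambda>\<eta>. \<Oplus>\<^bsub>H1_U Q\<^esub>i\<in>{..<n}. compose (carrier (Au Q)) (\<eta> i) (block_proj Q (q i) (e i)))"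
    using bij_betw_imp_inj_on[OF assms(3)] e by (intro linear_iso_pullback)
  moreover have "linear_iso (direct_sum_module {..<n} (\<lambda>i. H1_U (1\<^sub>m (e i))))
      (direct_sum_module {..<n} (\<lambda>i. module_mat TYPE(complex) (e i) (e i)))
      (\<lambda>\<eta>. \<lambda>i\<in>{..<n}. mat (e i) (e i) (\<lambda>(j, k). \<eta> i (au_gen (1\<^sub>m (e i)) j k)))"
    by (rule linear_iso_direct_sum) (rule linear_iso_H1_U_one)
  ultimately show ?thesis using e linear_map_pullback by blast
qed

end
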